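(* Let $\sigma\ge1$ and $\omega\in\mathbb{R}^n$, and let $\mathbf P$ be a positive, decreasing, integrable function on $J_0=[0,+\infty)$. Let $Z:\mathbb{T}^n\times J_0\to\mathbb{R}^n$ be a time-dependent vector field of the form $Z(q,t)=\omega+P(q,t)$ with $P\in\bar{\mathcal S}^0_{\sigma,1}$ and $|P^t|_{C^{\sigma+1}}\le\mathbf P(t)$ for all $t\in J_0$. Then there exists a $C^\sigma$-asymptotic KAM torus $\psi^t$ associated to $(Z,\omega,\mathrm{Id})$.
   Context: $\mathbb{T}^n=\mathbb{R}^n/\mathbb{Z}^n$; $J_\upsilon=[\upsilon,+\infty)$; $P^t(q)=P(q,t)$. Hölder norms: for integer $k\ge0$, $|f|_{C^k}=\sup_{|\alpha|\le k}\sup|\partial^\alpha f|$; for $\sigma=k+\mu$ with $0<\mu<1$, $|f|_{C^\sigma}=\sup_{|\alpha|\le k}\sup|\partial^\alpha f|+\sup_{|\alpha|=k}\sup_{x\ne y}|\partial^\alpha f(x)-\partial^\alpha f(y)|/|x-y|^\mu$; $C^\sigma$ is the space of $C^k$ functions with finite norm; for vector-valued functions take the maximum over the components. $\mathcal{S}^\upsilon_\sigma$ is the space of continuous functions $f$ on $\mathbb{T}^n\times J_\upsilon$ such that $f^t\in C^\sigma(\mathbb{T}^n)$ for all $t\in J_\upsilon$; $\bar{\mathcal S}^\upsilon_{\sigma,k}$ is the space of $f\in\mathcal{S}^\upsilon_{\sigma+k}$ such that all partial derivatives $\partial_q^if$ of order $i$ belong to $\mathcal{S}^\upsilon_{\sigma+k-i}$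 for $0\le i\le k$. $C^\sigma$-asymptotic KAM torus (on $\mathcal{P}=\mathbb{T}^n$): let $X^t,X_0^t$ be time-dependent vector fields on $\mathcal{P}$ of class $C^{\sigma+k}$ for all $t\in J_\upsilon$ (some $\upsilon\ge0$ and some integer $k\ge0$) and $\varphi_0:\mathbb{T}^n\to\mathcal{P}$ a $C^\sigma$ embedding with (i) $\lim_{t\to+\infty}|X^t-X_0^t|_{C^{\sigma+k}}=0$ and (ii) $X_0(\varphi_0(q),t)=\partial_q\varphi_0(q)\omega$ for all $(q,t)\in\mathbb{T}^n\times J_\upsilon$. A family of $C^\sigma$ embeddings $\varphi^t:\mathbb{T}^n\to\mathcal{P}$ is a $C^\sigma$-asymptotic KAM torus associated to $(X,X_0,\varphi_0)$ if there is $\upsilon'\ge\upsilon$ such that $\lim_{t\to+\infty}|\varphi^t-\varphi_0|_{C^\sigma}=0$ and $X(\varphi(q,t),t)=\partial_q\varphi(q,t)\omega+\partial_t\varphi(q,t)$ for all $(q,t)\in\mathbb{T}^n\times J_{\upsilon'}$, where $\varphi(q,t)=\varphi^t(q)$. Here $X=Z$, $X_0$ is the constant vector field $\omega$ and $\varphi_0=\mathrm{Id}$ is the identity of $\mathbb{T}^n$. *)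

theory Defs
  imports "HOL-Analysis.Analysis"
begin

definition torus_rel :: "real ^ 'n \<Rightarrow> real ^ 'n \<Rightarrow> bool" where
  "torus_rel x y \<longleftrightarrow> (\<forall>i. x $ i - y $ i \<in> \<int>)"

quotient_type 'n torus = "real ^ 'n::finite" / torus_rel
  morphisms rep_torus to_torus
proof (rule equivpI)
  show "reflp torus_rel"
    by (simp add: reflp_def torus_rel_def)
  show "symp torus_rel"
    unfolding symp_def torus_rel_def by (metis Ints_minus minus_diff_eq)
  show "transp torus_rel"
    unfolding transp_def torus_rel_def
    by (metis Ints_add add.commute diff_add_cancel diff_add_eq)
qed

instantiation torus :: (finite) ab_group_add
begin

lift_definition zero_torus :: "'a torus" is "0" .

lift_definition plus_torus :: "'a torus \<Rightarrow> 'a torus \<Rightarrow> 'a torus" is "(+)"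
  unfolding torus_rel_def by (simp add: add_diff_add)

lift_definition uminus_torus :: "'a torus \<Rightarrow> 'a torus" is uminus
  unfolding torus_rel_def by (metis Ints_minus minus_diff_minus vector_uminus_component)

lift_definition minus_torus :: "'a torus \<Rightarrow> 'a torus \<Rightarrow> 'a torus" is "(-)"
proof -
  fix a b c d :: "real ^ 'a"
  assume "torus_rel a b" "torus_rel c d"
  moreover have "(a - c) $ i - (b - d) $ i = (a $ i - b $ i) - (c $ i - d $ i)" for i
    by simp
  ultimately show "torus_rel (a - c) (b - d)"
    unfolding torus_rel_def by (metis Ints_diff)
qed

instance
  by standard (transfer, simp add: torus_rel_def algebra_simps)+

end

lemma to_torus_add: "to_torus (x + y) = to_torus x + to_torus y"
  by transfer (simp add: torus_rel_def)

lemma to_torus_diff: "to_torus (x - y) = to_torus x - to_torus y"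
  by transfer (simp add: torus_rel_def)

lemma to_torus_minus: "to_torus (- x) = - to_torus x"
  by transfer (simp add: torus_rel_def)

lemma to_torus_0: "to_torus 0 = 0"
  by transfer (simp add: torus_rel_def)

lemma to_torus_eq_iff: "to_torus x = to_torus y \<longleftrightarrow> (\<forall>i. x $ i - y $ i \<in> \<int>)"
  by (metis torus.abs_eq_iff torus_rel_def)

lemma to_torus_surj: "\<exists>x. to_torus x = q"
  by (metis Quotient_abs_rep Quotient_torus)

instantiation torus :: (finite) metric_space
begin

definition dist_torus :: "'a torus \<Rightarrow> 'a torus \<Rightarrow> real" where
  "dist_torus p q = Inf {norm v | v. to_torus v = p - q}"

definition uniformity_torus :: "('a torus \<times> 'a torus) filter" where
  "uniformity_torus = (INF e\<in>{0 <..}. principal {(x, y). dist x y < e})"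

definition open_torus :: "'a torus set \<Rightarrow> bool" where
  "open_torus U \<longleftrightarrow> (\<forall>x\<in>U. eventually (\<lambda>(x', y). x' = x \<longrightarrow> y \<in> U) uniformity)"

lemma dist_torus_le: "to_torus v = p - q \<Longrightarrow> dist p q \<le> norm v"
  unfolding dist_torus_def by (rule cInf_lower) (auto intro: bdd_belowI[of _ 0])

lemma dist_torus_less:
  assumes "dist p q < e"
  shows "\<exists>v. to_torus v = p - (q :: 'a torus) \<and> norm v < e"
proof -
  obtain x where "to_torus x = p - q" using to_torus_surj by blast
  then have "{norm v | v. to_torus v = p - q} \<noteq> {}" by blast
  from cInf_lessD[OF this assms[unfolded dist_torus_def]] show ?thesis by blast
qed

instance
proof
  fix p q r :: "'a torus"
  show "dist p q = 0 \<longleftrightarrow> p = q"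
  proof
    assume z: "dist p q = 0"
    obtain v where v: "to_torus v = p - q" "norm v < 1 / 2"
      using dist_torus_less[of p q "1/2"] z by auto
    have "v = 0"
    proof (rule ccontr)
      assume "v \<noteq> 0"
      then obtain w where w: "to_torus w = p - q" "norm w < norm v"
        using dist_torus_less[of p q "norm v"] z by auto
      have "v $ i = w $ i" for i
      proof -
        have "v $ i - w $ i \<in> \<int>"
          using v(1) w(1) to_torus_eq_iff by metis
        moreover have "\<bar>v $ i - w $ i\<bar> < 1"
          using component_le_norm_cart[of v i] component_le_norm_cart[of w i] v(2) w(2)
          by linarith
        ultimately have "v $ i - w $ i = 0"
          by (metis Ints_nonzero_abs_less1)
        then show ?thesis by simp
      qed
      then have "v = w" by (simp add: vec_eq_iff)
      with w(2) show False by simp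
    qed
    with v(1) show "p = q" by (simp add: to_torus_0)
  next
    assume "p = q"
    then have "dist p q \<le> 0"
      using dist_torus_le[of 0 p q] by (simp add: to_torus_0)
    moreover have "dist p q \<ge> 0"
      using dist_torus_less[of p q 0] by (meson norm_ge_zero not_le)
    ultimately show "dist p q = 0" by simp
  qed
  show "dist p q \<le> dist p r + dist q r"
  proof (rule field_le_epsilon)
    fix e :: real
    assume "e > 0"
    obtain v where v: "to_torus v = p - r" "norm v < dist p r + e / 2"
      using dist_torus_less[of p r "dist p r + e / 2"] \<open>e > 0\<close> by auto
    obtain w where w: "to_torus w = q - r" "norm w < dist q r + e / 2"
      using dist_torus_less[of q r "dist q r + e / 2"] \<open>e > 0\<close> by auto
    have "to_torus (v - w) = p - q"
      using v(1) w(1) by (simp add: to_torus_diff)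
    then have "dist p q \<le> norm (v - w)" by (rule dist_torus_le)
    also have "\<dots> \<le> norm v + norm w" by (rule norm_triangle_ineq4)
    finally show "dist p q \<le> dist p r + dist q r + e" using v(2) w(2) by simp
  qed
qed (simp_all add: uniformity_torus_def open_torus_def)

end

definition torus_pderiv :: "'n::finite \<Rightarrow> ('n torus \<Rightarrow> real) \<Rightarrow> 'n torus \<Rightarrow> real" where
  "torus_pderiv i f q = deriv (\<lambda>s. f (q + to_torus (s *\<^sub>R axis i 1))) 0"

text \<open>A multi-index \<open>\<alpha>\<close> is encoded by a list of coordinate directions, with
  \<open>|\<alpha>| = length \<alpha>\<close>.  For functions of class \<open>C\<^sup>k\<close> the order of
  differentiation is irrelevant when \<open>|\<alpha>| \<le> k\<close>, so suprema over such lists and over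
  multi-indices coincide.\<close>

definition torus_pderivs :: "'n::finite list \<Rightarrow> ('n torus \<Rightarrow> real) \<Rightarrow> 'n torus \<Rightarrow> real" where
  "torus_pderivs \<alpha> f = foldr torus_pderiv \<alpha> f"

definition torus_Ck :: "nat \<Rightarrow> ('n::finite torus \<Rightarrow> real) \<Rightarrow> bool" where
  "torus_Ck k f \<longleftrightarrow>
     (\<forall>\<alpha>. length \<alpha> \<le> k \<longrightarrow> continuous_on UNIV (torus_pderivs \<alpha> f)) \<and>
     (\<forall>\<alpha> i q. length \<alpha> < k \<longrightarrow>
        (\<lambda>s. torus_pderivs \<alpha> f (q + to_torus (s *\<^sub>R axis i 1))) differentiable (at (0::real)))"

definition holder_norm :: "real \<Rightarrow> ('n::finite torus \<Rightarrow> real) \<Rightarrow> ennreal" where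
  "holder_norm \<sigma> f =
     (let k = nat \<lfloor>\<sigma>\<rfloor>; \<mu> = frac \<sigma> in
       (SUP \<alpha>\<in>{\<alpha>. length \<alpha> \<le> k}. SUP q. ennreal \<bar>torus_pderivs \<alpha> f q\<bar>) +
       (if \<mu> = 0 then 0
        else SUP \<alpha>\<in>{\<alpha>. length \<alpha> = k}. SUP (p, q)\<in>{(p, q). p \<noteq> q}.
          ennreal (\<bar>torus_pderivs \<alpha> f p - torus_pderivs \<alpha> f q\<bar> / dist p q powr \<mu>)))"

definition holder_class :: "real \<Rightarrow> ('n::finite torus \<Rightarrow> real) \<Rightarrow> bool" where
  "holder_class \<sigma> f \<longleftrightarrow> torus_Ck (nat \<lfloor>\<sigma>\<rfloor>) f \<and> holder_norm \<sigma> f < \<infinity>"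

definition holder_norm_vec :: "real \<Rightarrow> ('n::finite torus \<Rightarrow> real ^ 'm) \<Rightarrow> ennreal" where
  "holder_norm_vec \<sigma> f = (MAX j\<in>UNIV. holder_norm \<sigma> (\<lambda>q. f q $ j))"

definition holder_class_vec :: "real \<Rightarrow> ('n::finite torus \<Rightarrow> real ^ 'm) \<Rightarrow> bool" where
  "holder_class_vec \<sigma> f \<longleftrightarrow> (\<forall>j. holder_class \<sigma> (\<lambda>q. f q $ j))"

definition S_space :: "real \<Rightarrow> real \<Rightarrow> ('n::finite torus \<Rightarrow> real \<Rightarrow> real) set" where
  "S_space \<upsilon> \<sigma> = {f. continuous_on (UNIV \<times> {\<upsilon>..}) (\<lambda>(q, t). f q t) \<and>
     (\<forall>t\<ge>\<upsilon>. holder_class \<sigma> (\<lambda>q. f q t))}"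

definition Sbar_space :: "real \<Rightarrow> real \<Rightarrow> nat \<Rightarrow> ('n::finite torus \<Rightarrow> real \<Rightarrow> real) set" where
  "Sbar_space \<upsilon> \<sigma> k = {f \<in> S_space \<upsilon> (\<sigma> + real k).
     \<forall>i\<le>k. \<forall>\<alpha>. length \<alpha> = i \<longrightarrow>
       (\<lambda>q t. torus_pderivs \<alpha> (\<lambda>p. f p t) q) \<in> S_space \<upsilon> (\<sigma> + real k - real i)}"

definition Sbar_space_vec ::
    "real \<Rightarrow> real \<Rightarrow> nat \<Rightarrow> ('n::finite torus \<Rightarrow> real \<Rightarrow> real ^ 'm) set" where
  "Sbar_space_vec \<upsilon> \<sigma> k = {f. \<forall>j. (\<lambda>q t. f q t $ j) \<in> Sbar_space \<upsilon> \<sigma> k}"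

text \<open>Tangent spaces of the torus are identified with \<open>real ^ 'n\<close>.  The lifts \<open>F\<close> and
  \<open>c\<close> below are arbitrary pointwise lifts, required to be differentiable only at the base point.
  Two lifts differ there by a locally constant integer vector, so the derivative is unique
  (for curves, if \<open>t\<close> is an accumulation point of \<open>S\<close>).\<close>

definition torus_has_derivative ::
    "('n::finite torus \<Rightarrow> 'n torus) \<Rightarrow> (real ^ 'n \<Rightarrow> real ^ 'n) \<Rightarrow> 'n torus \<Rightarrow> bool" where
  "torus_has_derivative f D q \<longleftrightarrow>
     (\<exists>F. (\<forall>v. to_torus (F v) = f (q + to_torus v)) \<and> (F has_derivative D) (at 0))"

definition torus_has_velocity ::
    "(real \<Rightarrow> 'n::finite torus) \<Rightarrow> real ^ 'n \<Rightarrow> real \<Rightarrow> real set \<Rightarrow> bool" where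
  "torus_has_velocity \<gamma> w t S \<longleftrightarrow>
     (\<exists>c. (\<forall>s. to_torus (c s) = \<gamma> s) \<and> (c has_vector_derivative w) (at t within S))"

text \<open>Every continuous self-map of the torus lifts to \<open>x \<mapsto> A x + u(x)\<close> with an integer
  matrix \<open>A\<close> (its action on the fundamental group) and a periodic \<open>u\<close>; the map has the
  regularity of \<open>u\<close>.\<close>

definition torus_map_class :: "real \<Rightarrow> ('n::finite torus \<Rightarrow> 'n torus) \<Rightarrow> bool" where
  "torus_map_class \<sigma> f \<longleftrightarrow>
     (\<exists>(A :: real ^ 'n ^ 'n) u. (\<forall>i j. A $ i $ j \<in> \<int>) \<and> holder_class_vec \<sigma> u \<and>
        (\<forall>x. f (to_torus x) = to_torus (A *v x + u (to_torus x))))"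

definition torus_embedding :: "real \<Rightarrow> ('n::finite torus \<Rightarrow> 'n torus) \<Rightarrow> bool" where
  "torus_embedding \<sigma> f \<longleftrightarrow>
     torus_map_class \<sigma> f \<and>
     (\<forall>q. \<exists>D. torus_has_derivative f D q \<and> inj D) \<and>
     embedding_map euclidean euclidean f"

text \<open>\<open>|\<phi>\<^sup>t - \<phi>\<^sub>0| \<rightarrow> 0\<close> in \<open>C\<^sup>\<sigma>\<close>: maps that are uniformly
  close differ by a function with values in \<open>real ^ 'n\<close>, and it is the norm of this function
  that is meant.\<close>

definition torus_maps_tendsto ::
    "real \<Rightarrow> (real \<Rightarrow> 'n::finite torus \<Rightarrow> 'n torus) \<Rightarrow> ('n torus \<Rightarrow> 'n torus) \<Rightarrow> bool" where
  "torus_maps_tendsto \<sigma> \<phi> \<phi>0 \<longleftrightarrow>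
     (\<exists>u :: real \<Rightarrow> 'n torus \<Rightarrow> real ^ 'n.
        (\<forall>\<^sub>F t in at_top. holder_class_vec \<sigma> (u t) \<and> (\<forall>q. \<phi> t q - \<phi>0 q = to_torus (u t q))) \<and>
        ((\<lambda>t. holder_norm_vec \<sigma> (u t)) \<longlongrightarrow> 0) at_top)"

definition KAM_setting ::
    "real \<Rightarrow> real ^ 'n::finite \<Rightarrow> real \<Rightarrow> nat \<Rightarrow>
     ('n torus \<Rightarrow> real \<Rightarrow> real ^ 'n) \<Rightarrow> ('n torus \<Rightarrow> real \<Rightarrow> real ^ 'n) \<Rightarrow>
     ('n torus \<Rightarrow> 'n torus) \<Rightarrow> bool" where
  "KAM_setting \<sigma> \<omega> \<upsilon> k X X0 \<phi>0 \<longleftrightarrow>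
     \<upsilon> \<ge> 0 \<and>
     (\<forall>t\<ge>\<upsilon>. holder_class_vec (\<sigma> + real k) (\<lambda>q. X q t) \<and>
              holder_class_vec (\<sigma> + real k) (\<lambda>q. X0 q t)) \<and>
     torus_embedding \<sigma> \<phi>0 \<and>
     ((\<lambda>t. holder_norm_vec (\<sigma> + real k) (\<lambda>q. X q t - X0 q t)) \<longlongrightarrow> 0) at_top \<and>
     (\<forall>q. \<forall>t\<ge>\<upsilon>. \<exists>D. torus_has_derivative \<phi>0 D q \<and> X0 (\<phi>0 q) t = D \<omega>)"

text \<open>The vector fields \<open>X\<close> and \<open>X0\<close> are those on the torus times \<open>{\<upsilon>..}\<close>.  At the
  endpoint \<open>\<upsilon>'\<close> the time derivative is one-sided.\<close>

definition asymptotic_KAM_torus ::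
    "real \<Rightarrow> real ^ 'n::finite \<Rightarrow> real \<Rightarrow>
     ('n torus \<Rightarrow> real \<Rightarrow> real ^ 'n) \<Rightarrow> ('n torus \<Rightarrow> real \<Rightarrow> real ^ 'n) \<Rightarrow>
     ('n torus \<Rightarrow> 'n torus) \<Rightarrow> (real \<Rightarrow> 'n torus \<Rightarrow> 'n torus) \<Rightarrow> bool" where
  "asymptotic_KAM_torus \<sigma> \<omega> \<upsilon> X X0 \<phi>0 \<phi> \<longleftrightarrow>
     (\<exists>k. KAM_setting \<sigma> \<omega> \<upsilon> k X X0 \<phi>0) \<and>
     (\<exists>\<upsilon>'\<ge>\<upsilon>.
        (\<forall>t\<ge>\<upsilon>'. torus_embedding \<sigma> (\<phi> t)) \<and>
        torus_maps_tendsto \<sigma> \<phi> \<phi>0 \<and>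
        (\<forall>q. \<forall>t\<ge>\<upsilon>'. \<exists>D w.
           torus_has_derivative (\<phi> t) D q \<and>
           torus_has_velocity (\<lambda>s. \<phi> s q) w t {\<upsilon>'..} \<and>
           X (\<phi> t q) t = D \<omega> + w))"

end

theory Submission
  imports Defs
begin

text \<open>
  The torus is sought in the form \<open>\<psi>\<^sup>t = id + u\<^sup>t\<close>, where \<open>id + u\<^sup>t\<close> should be the
  flow of \<open>\<omega> + P\<close> that starts from the linear flow at time infinity.  In the coordinates
  that rotate with \<open>\<omega>\<close>, that is for \<open>Q x t = P (x + t \<omega>) t\<close> and
  \<open>u t q = w (q - t \<omega>) t\<close>, the invariance equation loses its transport term and becomes, for
  each \<open>x\<close>, the ordinary differential equation \<open>w' = Q (x + w) t\<close> with \<open>w \<longlonglongrightarrow> 0\<close> at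
  infinity, which is equivalent to
  \<open>w x t = - (integral of Q (x + w x s) s over s \<ge> t)\<close>.  Since the norms of \<open>P\<close> are integrable
  in time, the right-hand side is a contraction in the uniform norm on times \<open>t \<ge> T\<close> once \<open>T\<close>
  is large (\<open>solution_vanishing_at_infinity\<close>).

  The regularity of \<open>w\<close> in \<open>x\<close> comes from the choice of the set on which the
  contraction acts, and the contraction itself takes place in the uniform norm.  Let
  \<open>k\<close> be the integer part of \<open>\<sigma>\<close>.  Because \<open>P\<^sup>t\<close> has \<open>k + 1\<close> bounded derivatives, its
  derivatives up to order \<open>k\<close> are Lipschitz; the predicate \<open>Ck_lip k B\<close> describes the ball of
  radius \<open>B\<close> of this class.  Such balls are stable under pointwise limits
  (\<open>Ck_lip_limit\<close>), integration over a parameter (\<open>Ck_lip_integral\<close>) and, up to a factor,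
  composition with a map near the identity (\<open>Ck_lip_compose_near_id\<close>).  Hence the functions whose
  slice at time \<open>t\<close> lies in the ball of radius \<open>\<beta> t\<close>, with \<open>\<beta> t\<close> a multiple of the integral
  of the bounds over \<open>{t..}\<close>, form a uniformly closed set that the integral operator preserves.

  Finally the class embeds into \<open>C\<^sup>\<sigma>\<close> with \<open>|f| \<le> 3 B\<close> (\<open>holder_norm_le\<close>), so the \<open>C\<^sup>\<sigma>\<close> norm of
  \<open>u\<^sup>t\<close> is at most \<open>3 \<beta> t\<close>, which tends to 0; and a displacement with small derivative yields an
  embedding of the torus (\<open>torus_embedding_displacement\<close>).
\<close>

section \<open>Gradients and Lipschitz bounds\<close>

lemma abs_inner_le_sum:
  fixes x v :: "real ^ 'n"
  assumes "\<And>i. \<bar>x $ i\<bar> \<le> b"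
  shows "\<bar>x \<bullet> v\<bar> \<le> real CARD('n) * b * norm v"
proof -
  have b: "0 \<le> b" using assms abs_ge_zero order_trans by blast
  have "\<bar>x \<bullet> v\<bar> \<le> (\<Sum>i\<in>UNIV. \<bar>x $ i * v $ i\<bar>)"
    unfolding inner_vec_def by simp
  also have "\<dots> \<le> (\<Sum>i\<in>(UNIV::'n set). b * norm v)"
    unfolding abs_mult
    by (intro sum_mono mult_mono assms component_le_norm_cart b) auto
  finally show ?thesis by simp
qed

lemma norm_le_card:
  fixes x :: "real ^ 'n"
  assumes "\<And>i. \<bar>x $ i\<bar> \<le> b"
  shows "norm x \<le> real CARD('n) * b"
proof -
  have "norm x \<le> (\<Sum>i\<in>UNIV. \<bar>x $ i\<bar>)" by (rule norm_le_l1_cart)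
  also have "\<dots> \<le> (\<Sum>i\<in>(UNIV::'n set). b)" by (intro sum_mono assms)
  finally show ?thesis by simp
qed

text \<open>The coordinates are changed one at a time: the induction runs over the set of coordinates
  already moved, and each step is the mean value inequality on a segment parallel to an axis, along
  which the partial derivative stays close to its value at \<open>x\<close>.\<close>

lemma has_derivative_of_continuous_partials:
  fixes f :: "real ^ 'n \<Rightarrow> real" and G :: "real ^ 'n \<Rightarrow> real ^ 'n"
  assumes partial: "\<And>x i. ((\<lambda>s. f (x + s *\<^sub>R axis i 1)) has_real_derivative G x $ i) (at 0)"
    and cont: "\<And>i. continuous_on UNIV (\<lambda>x. G x $ i)"
  shows "(f has_derivative (\<lambda>v. G x \<bullet> v)) (at x)"
  unfolding has_derivative_at_alt
proof (intro conjI allI impI)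
  show "bounded_linear (\<lambda>v. G x \<bullet> v)" by (rule bounded_linear_inner_right)
  fix e :: real assume e: "e > 0"
  define \<epsilon> where "\<epsilon> = e / CARD('n)"
  have \<epsilon>: "\<epsilon> > 0" using e by (simp add: \<epsilon>_def)
  have "isCont G x"
  proof -
    have "continuous_on UNIV (\<lambda>x. \<chi> i. G x $ i)" by (intro continuous_on_vec_lambda cont)
    then show ?thesis by (simp add: continuous_on_eq_continuous_at)
  qed
  then obtain d where d: "d > 0" "\<And>y. dist y x < d \<Longrightarrow> dist (G y) (G x) < \<epsilon>"
    using \<epsilon> unfolding continuous_at_eps_delta by metis
  have main: "\<bar>f (x + (\<chi> i. if i \<in> I then v $ i else 0)) - f x - (\<Sum>i\<in>I. G x $ i * v $ i)\<bar>
      \<le> \<epsilon> * (\<Sum>i\<in>I. \<bar>v $ i\<bar>)" if v: "norm v < d" for v :: "real ^ 'n" and I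
    using finite[of I]
  proof (induction I rule: finite_induct)
    case empty
    have "(\<chi> i. 0) = (0 :: real ^ 'n)" by (simp add: vec_eq_iff)
    then show ?case by simp
  next
    case (insert j I)
    define y where "y = x + (\<chi> i. if i \<in> I then v $ i else 0)"
    have y: "y + (v $ j) *\<^sub>R axis j 1 = x + (\<chi> i. if i \<in> insert j I then v $ i else 0)"
      using insert.hyps by (auto simp: y_def vec_eq_iff axis_def)
    define h where "h s = f (y + s *\<^sub>R axis j 1) - G x $ j * s" for s
    have dh: "(h has_real_derivative G (y + s *\<^sub>R axis j 1) $ j - G x $ j) (at s)" for s
    proof -
      have "((\<lambda>r. f ((y + s *\<^sub>R axis j 1) + (r - s) *\<^sub>R axis j 1)) has_real_derivative
          G (y + s *\<^sub>R axis j 1) $ j * 1) (at s)"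
        by (rule DERIV_chain2[where g = "\<lambda>r. r - s"])
          (use partial in \<open>auto intro!: derivative_eq_intros\<close>)
      then have "((\<lambda>r. f (y + r *\<^sub>R axis j 1)) has_real_derivative
          G (y + s *\<^sub>R axis j 1) $ j) (at s)"
        by (simp add: algebra_simps)
      then show ?thesis unfolding h_def by (auto intro!: derivative_eq_intros)
    qed
    have "norm (h (v $ j) - h 0) \<le> \<epsilon> * norm (v $ j - 0)"
    proof (rule field_differentiable_bound[where S = "closed_segment 0 (v $ j)"])
      fix s assume "s \<in> closed_segment 0 (v $ j)"
      then have s: "\<bar>s\<bar> \<le> \<bar>v $ j\<bar>"
        by (auto simp: closed_segment_eq_real_ivl split: if_splits)
      have "norm (y + s *\<^sub>R axis j 1 - x) \<le> norm v"
        by (rule norm_le_componentwise_cart) (use s insert.hyps in \<open>auto simp: y_def axis_def\<close>)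
      then have "dist (G (y + s *\<^sub>R axis j 1)) (G x) < \<epsilon>"
        using d(2) v by (simp add: dist_norm)
      then show "norm (G (y + s *\<^sub>R axis j 1) $ j - G x $ j) \<le> \<epsilon>"
        using component_le_norm_cart[of "G (y + s *\<^sub>R axis j 1) - G x" j] by (simp add: dist_norm)
      show "(h has_real_derivative G (y + s *\<^sub>R axis j 1) $ j - G x $ j)
          (at s within closed_segment 0 (v $ j))"
        by (rule has_field_derivative_at_within[OF dh])
    qed auto
    then have "\<bar>f (y + (v $ j) *\<^sub>R axis j 1) - f y - G x $ j * v $ j\<bar> \<le> \<epsilon> * \<bar>v $ j\<bar>"
      by (simp add: h_def algebra_simps)
    then show ?case
      using insert unfolding y[symmetric] y_def[symmetric]
      by (simp add: algebra_simps)
  qed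
  show "\<exists>d>0. \<forall>y. norm (y - x) < d \<longrightarrow> norm (f y - f x - G x \<bullet> (y - x)) \<le> e * norm (y - x)"
  proof (intro exI[of _ d] conjI allI impI d(1))
    fix y assume y: "norm (y - x) < d"
    have xy: "x + (\<chi> i. y $ i - x $ i) = y" by (simp add: vec_eq_iff)
    have "\<bar>f y - f x - G x \<bullet> (y - x)\<bar> \<le> \<epsilon> * (\<Sum>i\<in>UNIV. \<bar>(y - x) $ i\<bar>)"
      using main[OF y, of UNIV] xy by (simp add: inner_vec_def)
    also have "\<dots> \<le> \<epsilon> * (\<Sum>i\<in>(UNIV :: 'n set). norm (y - x))"
      using \<epsilon> by (intro mult_left_mono sum_mono component_le_norm_cart) auto
    also have "\<dots> = e * norm (y - x)" by (simp add: \<epsilon>_def)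
    finally show "norm (f y - f x - G x \<bullet> (y - x)) \<le> e * norm (y - x)" by simp
  qed
qed

lemma lipschitz_of_gradient_bound:
  fixes f :: "real ^ 'n \<Rightarrow> real"
  assumes "\<And>x. (f has_derivative (\<lambda>v. G x \<bullet> v)) (at x)" "\<And>x i. \<bar>G x $ i\<bar> \<le> b"
  shows "\<bar>f x - f y\<bar> \<le> real CARD('n) * b * norm (x - y)"
proof -
  have "norm (f x - f y) \<le> (real CARD('n) * b) * norm (x - y)"
  proof (rule differentiable_bound[of UNIV])
    fix x show "(f has_derivative (\<lambda>v. G x \<bullet> v)) (at x within UNIV)" using assms(1) by simp
    show "onorm (\<lambda>v. G x \<bullet> v) \<le> real CARD('n) * b"
    proof (rule onorm_bound)
      have "0 \<le> b" using assms(2) abs_ge_zero order_trans by blast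
      then show "0 \<le> real CARD('n) * b" by simp
      show "norm (G x \<bullet> v) \<le> real CARD('n) * b * norm v" for v
        using abs_inner_le_sum[OF assms(2)] by simp
    qed
  qed auto
  then show ?thesis by simp
qed

section \<open>Balls of functions with Lipschitz derivatives\<close>

text \<open>The ball of radius \<open>B\<close> in \<open>C\<^sup>k\<^sup>,\<^sup>1\<close>.  The recursion on the gradient, rather than on
  multi-indices, lets every closure property below be proved by one induction on \<open>k\<close> with the
  usual differentiation rule as its step.\<close>

primrec Ck_lip :: "nat \<Rightarrow> real \<Rightarrow> (real ^ 'n \<Rightarrow> real) \<Rightarrow> bool" where
  "Ck_lip 0 B f \<longleftrightarrow>
     (\<forall>x. \<bar>f x\<bar> \<le> B) \<and> (\<forall>x y. \<bar>f x - f y\<bar> \<le> B * norm (x - y))"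
| "Ck_lip (Suc k) B f \<longleftrightarrow>
     (\<forall>x. \<bar>f x\<bar> \<le> B) \<and> (\<forall>x y. \<bar>f x - f y\<bar> \<le> B * norm (x - y)) \<and>
     (\<exists>G :: real ^ 'n \<Rightarrow> real ^ 'n. (\<forall>x. (f has_derivative (\<lambda>v. G x \<bullet> v)) (at x)) \<and>
          (\<forall>i. Ck_lip k B (\<lambda>x. G x $ i)))"

lemma Ck_lip_bound: "Ck_lip k B f \<Longrightarrow> \<bar>f x\<bar> \<le> B"
  by (cases k) auto

lemma Ck_lip_lipschitz: "Ck_lip k B f \<Longrightarrow> \<bar>f x - f y\<bar> \<le> B * norm (x - y)"
  by (cases k) auto

lemma Ck_lip_nonneg: "Ck_lip k B f \<Longrightarrow> 0 \<le> B"
  using Ck_lip_bound[of k B f 0] by linarith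

lemma Ck_lip_SucE:
  assumes "Ck_lip (Suc k) B f"
  obtains G where "\<And>x. (f has_derivative (\<lambda>v. G x \<bullet> v)) (at x)" "\<And>i. Ck_lip k B (\<lambda>x. G x $ i)"
  using assms by auto

lemma Ck_lip_SucI:
  assumes "\<And>x. \<bar>f x\<bar> \<le> B" "\<And>x y. \<bar>f x - f y\<bar> \<le> B * norm (x - y)"
    and "\<And>x. (f has_derivative (\<lambda>v. G x \<bullet> v)) (at x)" "\<And>i. Ck_lip k B (\<lambda>x. G x $ i)"
  shows "Ck_lip (Suc k) B f"
  using assms by auto

lemma Ck_lip_mono: "Ck_lip k B f \<Longrightarrow> B \<le> B' \<Longrightarrow> Ck_lip k B' f"
proof (induction k arbitrary: f)
  case 0
  have "\<bar>f x - f y\<bar> \<le> B' * norm (x - y)" for x y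
    using 0 mult_right_mono[OF 0(2), of "norm (x - y)"] by (auto intro: order_trans)
  then show ?case using 0 by (auto intro: order_trans)
next
  case (Suc k)
  have "\<bar>f x - f y\<bar> \<le> B' * norm (x - y)" for x y
    using Suc.prems mult_right_mono[OF Suc.prems(2), of "norm (x - y)"] by (auto intro: order_trans)
  moreover have "\<bar>f x\<bar> \<le> B'" for x using Suc.prems by (auto intro: order_trans)
  ultimately show ?case using Suc by auto
qed

lemma Ck_lip_lower: "Ck_lip (Suc k) B f \<Longrightarrow> Ck_lip k B f"
proof (induction k arbitrary: f)
  case 0
  then show ?case by auto
next
  case (Suc k)
  obtain G where G: "\<And>x. (f has_derivative (\<lambda>v. G x \<bullet> v)) (at x)"
    "\<And>i. Ck_lip (Suc k) B (\<lambda>x. G x $ i)" using Ck_lip_SucE[OF Suc.prems] by blast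
  have "Ck_lip k B (\<lambda>x. G x $ i)" for i using G(2) by (rule Suc.IH)
  with G(1) Suc.prems show ?case by auto
qed

lemma Ck_lip_const: "\<bar>c\<bar> \<le> B \<Longrightarrow> Ck_lip k B (\<lambda>x :: real ^ 'n. c)"
proof (induction k arbitrary: c)
  case 0
  then show ?case by (auto intro: order_trans)
next
  case (Suc k)
  have "Ck_lip k B (\<lambda>x :: real ^ 'n. (0 :: real ^ 'n) $ i)" for i
    using Suc.IH[of 0] order_trans[OF abs_ge_zero Suc.prems] by simp
  moreover have "0 \<le> B * norm (x - y)" for x y :: "real ^ 'n" using Suc.prems by simp
  ultimately show ?case using Suc.prems
    by (auto intro!: exI[of _ "\<lambda>x. 0"] derivative_eq_intros)
qed

lemma Ck_lip_add: "Ck_lip k A f \<Longrightarrow> Ck_lip k B g \<Longrightarrow> Ck_lip k (A + B) (\<lambda>x. f x + g x)"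
proof (induction k arbitrary: f g)
  case 0
  have "\<bar>f x + g x - (f y + g y)\<bar> \<le> (A + B) * norm (x - y)" for x y
    using Ck_lip_lipschitz[OF 0(1), of x y] Ck_lip_lipschitz[OF 0(2), of x y]
    by (simp add: distrib_right)
  moreover have "\<bar>f x + g x\<bar> \<le> A + B" for x
    using Ck_lip_bound[OF 0(1), of x] Ck_lip_bound[OF 0(2), of x] by linarith
  ultimately show ?case by simp
next
  case (Suc k)
  obtain F where F: "\<And>x. (f has_derivative (\<lambda>v. F x \<bullet> v)) (at x)"
    "\<And>i. Ck_lip k A (\<lambda>x. F x $ i)" using Ck_lip_SucE[OF Suc.prems(1)] by blast
  obtain G where G: "\<And>x. (g has_derivative (\<lambda>v. G x \<bullet> v)) (at x)"
    "\<And>i. Ck_lip k B (\<lambda>x. G x $ i)" using Ck_lip_SucE[OF Suc.prems(2)] by blast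
  have "\<bar>f x + g x - (f y + g y)\<bar> \<le> (A + B) * norm (x - y)" for x y
    using Ck_lip_lipschitz[OF Suc.prems(1), of x y] Ck_lip_lipschitz[OF Suc.prems(2), of x y]
    by (simp add: distrib_right)
  moreover have "\<bar>f x + g x\<bar> \<le> A + B" for x
    using Ck_lip_bound[OF Suc.prems(1), of x] Ck_lip_bound[OF Suc.prems(2), of x] by linarith
  moreover have "Ck_lip k (A + B) (\<lambda>x. (F x + G x) $ i)" for i
    using Suc.IH[OF F(2) G(2)] by simp
  moreover have "((\<lambda>x. f x + g x) has_derivative (\<lambda>v. (F x + G x) \<bullet> v)) (at x)" for x
    using has_derivative_add[OF F(1) G(1)] by (simp add: inner_add_left)
  ultimately show ?case by (intro Ck_lip_SucI[where G = "\<lambda>x. F x + G x"])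
qed

lemma Ck_lip_sum:
  assumes "finite I" "\<And>i. i \<in> I \<Longrightarrow> Ck_lip k (b i) (f i)"
  shows "Ck_lip k (\<Sum>i\<in>I. b i) (\<lambda>x. \<Sum>i\<in>I. f i x)"
  using assms by (induction I rule: finite_induct) (auto intro: Ck_lip_const Ck_lip_add)

lemma Ck_lip_minus: "Ck_lip k B f \<Longrightarrow> Ck_lip k B (\<lambda>x. - f x)"
proof (induction k arbitrary: f)
  case 0
  then show ?case by (auto simp: abs_minus_commute)
next
  case (Suc k)
  obtain F where F: "\<And>x. (f has_derivative (\<lambda>v. F x \<bullet> v)) (at x)"
    "\<And>i. Ck_lip k B (\<lambda>x. F x $ i)" using Ck_lip_SucE[OF Suc.prems(1)] by blast
  have "((\<lambda>x. - f x) has_derivative (\<lambda>v. (- F x) \<bullet> v)) (at x)" for x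
    using has_derivative_minus[OF F(1)] by simp
  moreover have "Ck_lip k B (\<lambda>x. (- F x) $ i)" for i using Suc.IH[OF F(2)] by simp
  ultimately show ?case
    using Suc.prems by (intro Ck_lip_SucI[where G = "\<lambda>x. - F x"]) (auto simp: abs_minus_commute)
qed

text \<open>The factor \<open>2 ^ Suc k\<close> counts the terms of the Leibniz rule: each differentiation doubles
  their number, and so does the Lipschitz estimate.\<close>

lemma product_bounds:
  fixes f g :: "real ^ 'n \<Rightarrow> real"
  assumes f: "Ck_lip k A f" and g: "Ck_lip k B g"
  shows "\<bar>f x * g x\<bar> \<le> 2 ^ Suc k * A * B"
    and "\<bar>f x * g x - f y * g y\<bar> \<le> 2 ^ Suc k * A * B * norm (x - y)"
proof -
  have A: "0 \<le> A" and B: "0 \<le> B" using f g by (auto dest: Ck_lip_nonneg)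
  have p: "2 * (A * B) \<le> 2 ^ Suc k * A * B"
  proof -
    have "1 * (A * B) \<le> 2 ^ k * (A * B)" using A B by (intro mult_right_mono) auto
    then show ?thesis by (simp add: algebra_simps)
  qed
  have "\<bar>f x * g x\<bar> \<le> A * B"
    unfolding abs_mult using A B Ck_lip_bound[OF f] Ck_lip_bound[OF g] by (intro mult_mono) auto
  also have "\<dots> \<le> 2 * (A * B)" using A B by simp
  finally show "\<bar>f x * g x\<bar> \<le> 2 ^ Suc k * A * B" using p by linarith
  have "f x * g x - f y * g y = f x * (g x - g y) + (f x - f y) * g y" by (simp add: algebra_simps)
  then have "\<bar>f x * g x - f y * g y\<bar> \<le> \<bar>f x\<bar> * \<bar>g x - g y\<bar> + \<bar>f x - f y\<bar> * \<bar>g y\<bar>"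
    by (metis abs_mult abs_triangle_ineq)
  also have "\<dots> \<le> A * (B * norm (x - y)) + (A * norm (x - y)) * B"
    using A B Ck_lip_bound[OF f] Ck_lip_bound[OF g] Ck_lip_lipschitz[OF f] Ck_lip_lipschitz[OF g]
    by (intro add_mono mult_mono) auto
  also have "\<dots> = 2 * (A * B) * norm (x - y)" by (simp add: algebra_simps)
  also have "\<dots> \<le> 2 ^ Suc k * A * B * norm (x - y)" using p by (rule mult_right_mono) simp
  finally show "\<bar>f x * g x - f y * g y\<bar> \<le> 2 ^ Suc k * A * B * norm (x - y)" .
qed

lemma Ck_lip_mult:
  "Ck_lip k A f \<Longrightarrow> Ck_lip k B g \<Longrightarrow> Ck_lip k (2 ^ Suc k * A * B) (\<lambda>x. f x * g x)"
proof (induction k arbitrary: f g)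
  case 0
  then show ?case using product_bounds[OF 0] by simp
next
  case (Suc k)
  obtain F where F: "\<And>x. (f has_derivative (\<lambda>v. F x \<bullet> v)) (at x)"
    "\<And>i. Ck_lip k A (\<lambda>x. F x $ i)" using Ck_lip_SucE[OF Suc.prems(1)] by blast
  obtain G where G: "\<And>x. (g has_derivative (\<lambda>v. G x \<bullet> v)) (at x)"
    "\<And>i. Ck_lip k B (\<lambda>x. G x $ i)" using Ck_lip_SucE[OF Suc.prems(2)] by blast
  let ?H = "\<lambda>x. f x *\<^sub>R G x + g x *\<^sub>R F x"
  have "Ck_lip k (2 ^ Suc (Suc k) * A * B) (\<lambda>x. ?H x $ i)" for i
    using Ck_lip_add[OF Suc.IH[OF Ck_lip_lower[OF Suc.prems(1)] G(2)[of i]]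
        Suc.IH[OF F(2)[of i] Ck_lip_lower[OF Suc.prems(2)]]]
    by (simp add: algebra_simps)
  moreover have "((\<lambda>x. f x * g x) has_derivative (\<lambda>v. ?H x \<bullet> v)) (at x)" for x
    using has_derivative_mult[OF F(1) G(1)] by (simp add: inner_add_left algebra_simps)
  ultimately show ?case
    using product_bounds[OF Suc.prems] by (intro Ck_lip_SucI[where G = ?H])
qed

text \<open>The mean value inequality for \<open>y \<mapsto> f y - G x \<bullet> y\<close> on the segment from \<open>x\<close> to
  \<open>x + v\<close>, where the gradient of this function is at most of order \<open>norm v\<close>.  Together with
  the converse \<open>has_derivative_of_quadratic_error\<close> it replaces differentiability by an
  inequality, which survives limits and integration.\<close>

lemma gradient_taylor:
  fixes f :: "real ^ 'n \<Rightarrow> real"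
  assumes der: "\<And>x. (f has_derivative (\<lambda>v. G x \<bullet> v)) (at x)"
    and lip: "\<And>x y i. \<bar>G x $ i - G y $ i\<bar> \<le> B * norm (x - y)"
    and B: "0 \<le> B"
  shows "\<bar>f (x + v) - f x - G x \<bullet> v\<bar> \<le> real CARD('n) * B * (norm v)\<^sup>2"
proof -
  let ?h = "\<lambda>y. f y - G x \<bullet> y"
  have "norm (?h (x + v) - ?h x) \<le> (real CARD('n) * (B * norm v)) * norm (x + v - x)"
  proof (rule differentiable_bound[of "closed_segment x (x + v)"])
    fix y assume y: "y \<in> closed_segment x (x + v)"
    show "(?h has_derivative (\<lambda>w. (G y - G x) \<bullet> w)) (at y within closed_segment x (x + v))"
      by (rule has_derivative_at_withinI)
        (auto intro!: derivative_eq_intros der simp: inner_diff_left)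
    show "onorm (\<lambda>w. (G y - G x) \<bullet> w) \<le> real CARD('n) * (B * norm v)"
    proof (rule onorm_bound)
      show "0 \<le> real CARD('n) * (B * norm v)" using B by simp
      have "norm (y - x) \<le> norm v" using segment_bound1[OF y] by simp
      then have "\<bar>(G y - G x) $ i\<bar> \<le> B * norm v" for i
        using lip[of y i x] mult_left_mono[OF _ B] by fastforce
      then show "norm ((G y - G x) \<bullet> w) \<le> real CARD('n) * (B * norm v) * norm w" for w
        using abs_inner_le_sum[of "G y - G x"] by simp
    qed
  qed auto
  then show ?thesis by (simp add: power2_eq_square algebra_simps)
qed

lemma Ck_lip_taylor:
  fixes f :: "real ^ 'n \<Rightarrow> real"
  assumes "\<And>x. (f has_derivative (\<lambda>v. G x \<bullet> v)) (at x)" "\<And>i. Ck_lip k B (\<lambda>x. G x $ i)"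
  shows "\<bar>f (x + v) - f x - G x \<bullet> v\<bar> \<le> real CARD('n) * B * (norm v)\<^sup>2"
  by (rule gradient_taylor[OF assms(1) Ck_lip_lipschitz[OF assms(2)] Ck_lip_nonneg[OF assms(2)]])

lemma has_derivative_of_quadratic_error:
  fixes f :: "real ^ 'n \<Rightarrow> real"
  assumes "\<And>v. \<bar>f (x + v) - f x - g \<bullet> v\<bar> \<le> K * (norm v)\<^sup>2"
  shows "(f has_derivative (\<lambda>v. g \<bullet> v)) (at x)"
  unfolding has_derivative_at_alt
proof (intro conjI allI impI)
  show "bounded_linear (\<lambda>v. g \<bullet> v)" by (rule bounded_linear_inner_right)
  fix e :: real assume e: "e > 0"
  define d where "d = e / (\<bar>K\<bar> + 1)"
  have d: "d > 0" using e by (simp add: d_def)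
  have "norm (f y - f x - g \<bullet> (y - x)) \<le> e * norm (y - x)" if y: "norm (y - x) < d" for y
  proof -
    have "\<bar>f y - f x - g \<bullet> (y - x)\<bar> \<le> K * (norm (y - x))\<^sup>2" using assms[of "y - x"] by simp
    also have "\<dots> \<le> ((\<bar>K\<bar> + 1) * norm (y - x)) * norm (y - x)"
      by (simp add: power2_eq_square mult.assoc[symmetric] mult_right_mono)
    also have "\<dots> \<le> ((\<bar>K\<bar> + 1) * d) * norm (y - x)"
      using y by (intro mult_right_mono mult_left_mono) auto
    also have "(\<bar>K\<bar> + 1) * d = e" by (simp add: d_def add_pos_nonneg)
    finally show ?thesis by simp
  qed
  with d show "\<exists>d>0. \<forall>y. norm (y - x) < d \<longrightarrow>
      norm (f y - f x - g \<bullet> (y - x)) \<le> e * norm (y - x)" by blast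
qed

lemma abs_le_of_tendsto:
  fixes a :: "nat \<Rightarrow> real"
  assumes "a \<longlonglongrightarrow> l" "\<And>m. \<bar>a m\<bar> \<le> b"
  shows "\<bar>l\<bar> \<le> b"
  using tendsto_rabs[OF assms(1)] by (rule LIMSEQ_le_const2) (use assms(2) in blast)

text \<open>Interpolation: a difference quotient with step \<open>h\<close> approximates the gradient with error
  \<open>K h\<close>, uniformly in \<open>m\<close>.  Choosing \<open>h\<close> first and \<open>m\<close> afterwards makes convergence of the values
  imply convergence of the gradients.\<close>

lemma gradients_Cauchy:
  fixes F :: "nat \<Rightarrow> real ^ 'n \<Rightarrow> real"
  assumes taylor: "\<And>m x v. \<bar>F m (x + v) - F m x - G m x \<bullet> v\<bar> \<le> K * (norm v)\<^sup>2"
    and K: "0 \<le> K"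
    and lim: "\<And>x. convergent (\<lambda>m. F m x)"
  shows "Cauchy (\<lambda>m. G m x $ i)"
proof (rule CauchyI)
  fix e :: real assume e: "e > 0"
  define h where "h = e / (4 * (K + 1))"
  have h: "h > 0" using e K by (simp add: h_def)
  have Kh: "K * h \<le> e / 4"
    using e K by (simp add: h_def field_simps)
  let ?y = "x + h *\<^sub>R axis i 1"
  have C: "Cauchy (\<lambda>m. F m z)" for z using lim by (rule convergent_Cauchy)
  have "e * h / 8 > 0" using e h by simp
  then obtain M1 M2 where
    M1: "\<And>m l. m \<ge> M1 \<Longrightarrow> l \<ge> M1 \<Longrightarrow> norm (F m x - F l x) < e * h / 8" and
    M2: "\<And>m l. m \<ge> M2 \<Longrightarrow> l \<ge> M2 \<Longrightarrow> norm (F m ?y - F l ?y) < e * h / 8"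
    using CauchyD[OF C[of x]] CauchyD[OF C[of ?y]] by metis
  have "norm (G m x $ i - G l x $ i) < e" if "m \<ge> max M1 M2" "l \<ge> max M1 M2" for m l
  proof -
    have T: "\<bar>F m ?y - F m x - G m x $ i * h\<bar> \<le> (e / 4) * h" for m
    proof -
      have "\<bar>F m ?y - F m x - G m x $ i * h\<bar> \<le> K * h\<^sup>2"
        using taylor[of m x "h *\<^sub>R axis i 1"] by (simp add: inner_axis mult.commute)
      also have "\<dots> \<le> (e / 4) * h"
        using mult_right_mono[OF Kh, of h] h by (simp add: power2_eq_square mult.assoc)
      finally show ?thesis .
    qed
    have "\<bar>G m x $ i * h - G l x $ i * h\<bar> < e * h"
      using T[of m] T[of l] M1[of m l] M2[of m l] that by (simp add: abs_if split: if_splits)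
    then have "\<bar>G m x $ i - G l x $ i\<bar> * h < e * h"
      using h by (simp add: left_diff_distrib[symmetric] abs_mult)
    then show ?thesis using h by simp
  qed
  then show "\<exists>M. \<forall>m\<ge>M. \<forall>l\<ge>M. norm (G m x $ i - G l x $ i) < e" by blast
qed

text \<open>The gradients converge by \<open>gradients_Cauchy\<close>, the limit stays in the ball by induction,
  and it is the gradient of the limit function because the quadratic Taylor estimate passes to the
  limit.\<close>

lemma Ck_lip_limit:
  "(\<And>m. Ck_lip k B (F m)) \<Longrightarrow> (\<And>x. (\<lambda>m. F m x) \<longlonglongrightarrow> f x) \<Longrightarrow> Ck_lip k B f"
proof (induction k arbitrary: F f)
  case 0
  have "\<bar>f x\<bar> \<le> B" for x
    by (rule abs_le_of_tendsto[OF 0(2)]) (rule Ck_lip_bound[OF 0(1)])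
  moreover have "\<bar>f x - f y\<bar> \<le> B * norm (x - y)" for x y
    by (rule abs_le_of_tendsto[OF tendsto_diff[OF 0(2) 0(2)]]) (rule Ck_lip_lipschitz[OF 0(1)])
  ultimately show ?case by simp
next
  case (Suc k)
  have "\<bar>f x\<bar> \<le> B" for x
    by (rule abs_le_of_tendsto[OF Suc.prems(2)]) (rule Ck_lip_bound[OF Suc.prems(1)])
  moreover have "\<bar>f x - f y\<bar> \<le> B * norm (x - y)" for x y
    by (rule abs_le_of_tendsto[OF tendsto_diff[OF Suc.prems(2) Suc.prems(2)]])
      (rule Ck_lip_lipschitz[OF Suc.prems(1)])
  moreover
  have "\<forall>m. \<exists>G. (\<forall>x. (F m has_derivative (\<lambda>v. G x \<bullet> v)) (at x)) \<and>
      (\<forall>i. Ck_lip k B (\<lambda>x. G x $ i))"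
    using Suc.prems(1) by simp
  then obtain G where der: "\<And>m x. (F m has_derivative (\<lambda>v. G m x \<bullet> v)) (at x)"
    and G: "\<And>m i. Ck_lip k B (\<lambda>x. G m x $ i)" by metis
  let ?K = "real CARD('a) * B"
  have taylor: "\<bar>F m (x + v) - F m x - G m x \<bullet> v\<bar> \<le> ?K * (norm v)\<^sup>2" for m x v
    by (rule Ck_lip_taylor[OF der G])
  have B: "0 \<le> B" using Suc.prems(1) by (rule Ck_lip_nonneg)
  have "convergent (\<lambda>m. G m x $ i)" for x i
    by (intro Cauchy_convergent gradients_Cauchy[of F G ?K] taylor convergentI[OF Suc.prems(2)])
      (use B in simp)
  then obtain g where g: "\<And>x i. (\<lambda>m. G m x $ i) \<longlonglongrightarrow> g x i"
    unfolding convergent_def by metis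
  define g' where "g' x = (\<chi> i. g x i)" for x
  have G_lim: "(\<lambda>m. G m x) \<longlonglongrightarrow> g' x" for x
    by (rule vec_tendstoI) (simp add: g'_def g)
  have "Ck_lip k B (\<lambda>x. g' x $ i)" for i
    by (rule Suc.IH[where F = "\<lambda>m x. G m x $ i"]) (simp_all add: G g'_def g)
  moreover have "(f has_derivative (\<lambda>v. g' x \<bullet> v)) (at x)" for x
  proof (rule has_derivative_of_quadratic_error)
    show "\<bar>f (x + v) - f x - g' x \<bullet> v\<bar> \<le> ?K * (norm v)\<^sup>2" for v
      by (rule abs_le_of_tendsto[OF tendsto_diff[OF tendsto_diff[OF Suc.prems(2) Suc.prems(2)]
          tendsto_inner[OF G_lim tendsto_const]]]) (rule taylor)
  qed
  ultimately show ?case by auto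
qed

lemma has_derivative_vecI:
  fixes w :: "'a :: real_normed_vector \<Rightarrow> real ^ 'n"
  assumes "\<And>j. ((\<lambda>x. w x $ j) has_derivative (\<lambda>v. D v $ j)) (at x within S)"
  shows "(w has_derivative D) (at x within S)"
  unfolding has_derivative_componentwise_within[of w]
  using assms by (auto simp: Basis_vec_def inner_axis)

text \<open>The chain rule writes a partial derivative of the composition as
  \<open>\<partial>\<^sub>i Q\<close> composed with the map, plus \<open>n\<close> products of a composed \<open>\<partial>\<^sub>j Q\<close> with
  a derivative of \<open>w\<close>; induction and \<open>Ck_lip_mult\<close> bound these terms.  The constant
  depends only on \<open>k\<close> and the dimension, which makes it possible to choose the starting time of
  the contraction afterwards.\<close>

lemma Ck_lip_compose_near_id:
  "\<exists>C\<ge>1. \<forall>(Q :: real ^ 'n \<Rightarrow> real) B w. Ck_lip k B Q \<longrightarrow>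
     (\<forall>j. Ck_lip k 1 (\<lambda>x. w x $ j)) \<longrightarrow> Ck_lip k (C * B) (\<lambda>x. Q (x + w x))"
proof -
  let ?n = "real CARD('n)"
  have base: "\<bar>Q (x + w x)\<bar> \<le> (1 + ?n) * B \<and>
      \<bar>Q (x + w x) - Q (y + w y)\<bar> \<le> (1 + ?n) * B * norm (x - y)"
    if Q: "Ck_lip k B Q" and w: "\<And>j. Ck_lip k 1 (\<lambda>x. w x $ j)"
    for k B w x y and Q :: "real ^ 'n \<Rightarrow> real"
  proof
    have B: "0 \<le> B" using Q by (rule Ck_lip_nonneg)
    have "1 * B \<le> (1 + ?n) * B" using B by (intro mult_right_mono) auto
    then show "\<bar>Q (x + w x)\<bar> \<le> (1 + ?n) * B" using Ck_lip_bound[OF Q, of "x + w x"] by linarith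
    have "norm (w x - w y) \<le> ?n * norm (x - y)"
      using Ck_lip_lipschitz[OF w] by (intro norm_le_card) simp
    then have "norm ((x + w x) - (y + w y)) \<le> (1 + ?n) * norm (x - y)"
      using norm_triangle_ineq[of "x - y" "w x - w y"] by (simp add: algebra_simps)
    then show "\<bar>Q (x + w x) - Q (y + w y)\<bar> \<le> (1 + ?n) * B * norm (x - y)"
      using Ck_lip_lipschitz[OF Q, of "x + w x" "y + w y"] mult_left_mono[OF _ B]
      by (fastforce simp: mult_ac)
  qed
  \<comment> \<open>The bound \<open>1 + n\<close> on \<open>C\<close> is kept in the induction to dominate the sup and Lipschitz bounds of
    the undifferentiated composition.\<close>
  have "\<exists>C\<ge>1 + ?n. \<forall>(Q :: real ^ 'n \<Rightarrow> real) B w. Ck_lip k B Q \<longrightarrow>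
     (\<forall>j. Ck_lip k 1 (\<lambda>x. w x $ j)) \<longrightarrow> Ck_lip k (C * B) (\<lambda>x. Q (x + w x))"
  proof (induction k)
    case 0
    show ?case
    proof (intro exI[of _ "1 + ?n"] conjI allI impI)
      fix Q :: "real ^ 'n \<Rightarrow> real" and B and w :: "real ^ 'n \<Rightarrow> real ^ 'n"
      assume "Ck_lip 0 B Q" "\<forall>j. Ck_lip 0 1 (\<lambda>x. w x $ j)"
      then show "Ck_lip 0 ((1 + ?n) * B) (\<lambda>x. Q (x + w x))" using base[of 0 B Q w] by simp
    qed simp
  next
    case (Suc k)
    then obtain C where C: "C \<ge> 1 + ?n" and IH: "\<And>(Q :: real ^ 'n \<Rightarrow> real) B w. Ck_lip k B Q \<Longrightarrow>
     (\<And>j. Ck_lip k 1 (\<lambda>x. w x $ j)) \<Longrightarrow> Ck_lip k (C * B) (\<lambda>x. Q (x + w x))" by blast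
    let ?C = "C + ?n * (2 ^ Suc k * C)"
    have C': "1 + ?n \<le> ?C" using C by (simp add: add_increasing2)
    show ?case
    proof (intro exI[of _ ?C] conjI allI impI C')
      fix Q :: "real ^ 'n \<Rightarrow> real" and B and w :: "real ^ 'n \<Rightarrow> real ^ 'n"
      assume Q: "Ck_lip (Suc k) B Q" and w': "\<forall>j. Ck_lip (Suc k) 1 (\<lambda>x. w x $ j)"
      then have w: "\<And>j. Ck_lip (Suc k) 1 (\<lambda>x. w x $ j)" by blast
      have B: "0 \<le> B" using Q by (rule Ck_lip_nonneg)
      have CB: "(1 + ?n) * B \<le> ?C * B" using C' B by (rule mult_right_mono)
      obtain G where G: "\<And>x. (Q has_derivative (\<lambda>v. G x \<bullet> v)) (at x)"
        "\<And>i. Ck_lip k B (\<lambda>x. G x $ i)" using Ck_lip_SucE[OF Q] by blast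
      have "\<forall>j. \<exists>W. (\<forall>x. ((\<lambda>x. w x $ j) has_derivative (\<lambda>v. W x \<bullet> v)) (at x)) \<and>
          (\<forall>i. Ck_lip k 1 (\<lambda>x. W x $ i))"
        using w by simp
      then obtain W where W: "\<And>j x. ((\<lambda>x. w x $ j) has_derivative (\<lambda>v. W j x \<bullet> v)) (at x)"
        "\<And>j i. Ck_lip k 1 (\<lambda>x. W j x $ i)" by metis
      have wder: "(w has_derivative (\<lambda>v. \<chi> j. W j x \<bullet> v)) (at x)" for x
        by (rule has_derivative_vecI) (simp add: W)
      let ?H = "\<lambda>x. G (x + w x) + (\<Sum>j\<in>UNIV. G (x + w x) $ j *\<^sub>R W j x)"
      have "((\<lambda>x. Q (x + w x)) has_derivative (\<lambda>v. ?H x \<bullet> v)) (at x)" for x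
      proof -
        have "((\<lambda>x. Q (x + w x)) has_derivative (\<lambda>v. G (x + w x) \<bullet> (v + (\<chi> j. W j x \<bullet> v)))) (at x)"
          by (rule has_derivative_compose[of "\<lambda>x. x + w x" _ x UNIV Q])
            (auto intro!: derivative_intros wder G)
        moreover have "G (x + w x) \<bullet> (v + (\<chi> j. W j x \<bullet> v)) = ?H x \<bullet> v" for v
          by (simp add: inner_add_left inner_add_right inner_sum_left)
            (simp add: inner_vec_def)
        ultimately show ?thesis by simp
      qed
      moreover have "Ck_lip k (?C * B) (\<lambda>x. ?H x $ i)" for i
      proof -
        have lw: "\<And>j. Ck_lip k 1 (\<lambda>x. w x $ j)" using w by (rule Ck_lip_lower)
        have GC: "Ck_lip k (C * B) (\<lambda>x. G (x + w x) $ j)" for j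
          using IH[OF G(2)[of j] lw] .
        have "Ck_lip k (2 ^ Suc k * (C * B) * 1) (\<lambda>x. G (x + w x) $ j * W j x $ i)" for j
          by (rule Ck_lip_mult[OF GC W(2)])
        from Ck_lip_add[OF GC[of i] Ck_lip_sum[of UNIV, OF finite this]]
        show ?thesis by (simp add: algebra_simps)
      qed
      moreover have "\<bar>Q (x + w x)\<bar> \<le> ?C * B" for x
        using base[OF Q w, of x x] CB by linarith
      moreover have "\<bar>Q (x + w x) - Q (y + w y)\<bar> \<le> ?C * B * norm (x - y)" for x y
        using base[OF Q w, of x y] mult_right_mono[OF CB, of "norm (x - y)"] by auto
      ultimately show "Ck_lip (Suc k) (?C * B) (\<lambda>x. Q (x + w x))"
        by (intro Ck_lip_SucI[where G = ?H])
    qed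
  qed
  then obtain C where "C \<ge> 1 + ?n" and C: "\<forall>(Q :: real ^ 'n \<Rightarrow> real) B w. Ck_lip k B Q \<longrightarrow>
     (\<forall>j. Ck_lip k 1 (\<lambda>x. w x $ j)) \<longrightarrow> Ck_lip k (C * B) (\<lambda>x. Q (x + w x))" by blast
  then have "C \<ge> 1" by simp
  with C show ?thesis by blast
qed

lemma Ck_lip_translate: "Ck_lip k B f \<Longrightarrow> Ck_lip k B (\<lambda>x. f (x + a))"
proof (induction k arbitrary: f)
  case 0
  have "\<bar>f (x + a) - f (y + a)\<bar> \<le> B * norm (x - y)" for x y
    using Ck_lip_lipschitz[OF 0, of "x + a" "y + a"] by simp
  then show ?case using 0 by auto
next
  case (Suc k)
  obtain G where G: "\<And>x. (f has_derivative (\<lambda>v. G x \<bullet> v)) (at x)"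
    "\<And>i. Ck_lip k B (\<lambda>x. G x $ i)" using Ck_lip_SucE[OF Suc.prems] by blast
  show ?case
  proof (rule Ck_lip_SucI)
    show "\<bar>f (x + a)\<bar> \<le> B" for x by (rule Ck_lip_bound[OF Suc.prems])
    show "\<bar>f (x + a) - f (y + a)\<bar> \<le> B * norm (x - y)" for x y
      using Ck_lip_lipschitz[OF Suc.prems, of "x + a" "y + a"] by simp
    show "((\<lambda>x. f (x + a)) has_derivative (\<lambda>v. G (x + a) \<bullet> v)) (at x)" for x
      by (rule has_derivative_compose[of "\<lambda>x. x + a" _ x UNIV f])
        (auto intro!: derivative_eq_intros G)
    show "Ck_lip k B (\<lambda>x. G (x + a) $ i)" for i by (rule Suc.IH[OF G(2)])
  qed
qed

lemma integrable_dominated: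
  fixes f g :: "'s \<Rightarrow> real"
  assumes "integrable M g" "f \<in> borel_measurable M" "\<And>s. s \<in> space M \<Longrightarrow> \<bar>f s\<bar> \<le> g s"
  shows "integrable M f" "\<bar>\<integral>s. f s \<partial>M\<bar> \<le> (\<integral>s. g s \<partial>M)"
proof -
  show f: "integrable M f"
    by (rule Bochner_Integration.integrable_bound[OF assms(1,2)])
      (use assms(3) abs_ge_self order_trans in \<open>fastforce intro!: AE_I2\<close>)
  have "norm (\<integral>s. f s \<partial>M) \<le> (\<integral>s. norm (f s) \<partial>M)" by (rule integral_norm_bound)
  also have "\<dots> \<le> (\<integral>s. g s \<partial>M)"
    by (rule integral_mono[OF integrable_norm[OF f] assms(1)]) (use assms(3) in auto)
  finally show "\<bar>\<integral>s. f s \<partial>M\<bar> \<le> (\<integral>s. g s \<partial>M)" by simp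
qed

text \<open>Differentiation under the integral sign.  The gradient is measurable in the parameter as a
  pointwise limit of difference quotients, and the integrated quadratic Taylor estimate identifies
  the integral of the gradients as the gradient of the integral.\<close>

lemma Ck_lip_integral:
  assumes "\<And>s. s \<in> space M \<Longrightarrow> Ck_lip k (b s) (f s)"
    and "\<And>x. (\<lambda>s. f s x) \<in> borel_measurable M"
    and "integrable M b"
  shows "Ck_lip k (\<integral>s. b s \<partial>M) (\<lambda>x. \<integral>s. f s x \<partial>M)"
  using assms
proof (induction k arbitrary: f)
  case 0
  have int: "integrable M (\<lambda>s. f s x)" for x
    by (rule integrable_dominated(1)[OF 0(3,2)]) (rule Ck_lip_bound[OF 0(1)])
  have "\<bar>\<integral>s. f s x \<partial>M\<bar> \<le> (\<integral>s. b s \<partial>M)" for x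
    by (rule integrable_dominated(2)[OF 0(3,2)]) (rule Ck_lip_bound[OF 0(1)])
  moreover have "\<bar>(\<integral>s. f s x \<partial>M) - (\<integral>s. f s y \<partial>M)\<bar> \<le> (\<integral>s. b s \<partial>M) * norm (x - y)" for x y
  proof -
    have "\<bar>\<integral>s. f s x - f s y \<partial>M\<bar> \<le> (\<integral>s. b s * norm (x - y) \<partial>M)"
      by (rule integrable_dominated(2))
        (auto intro!: borel_measurable_diff 0 Ck_lip_lipschitz)
    then show ?thesis using int by simp
  qed
  ultimately show ?case by simp
next
  case (Suc k)
  let ?n = "real CARD('b)"
  have int: "integrable M (\<lambda>s. f s x)" for x
    by (rule integrable_dominated(1)[OF Suc.prems(3,2)]) (rule Ck_lip_bound[OF Suc.prems(1)])
  have "\<bar>\<integral>s. f s x \<partial>M\<bar> \<le> (\<integral>s. b s \<partial>M)" for x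
    by (rule integrable_dominated(2)[OF Suc.prems(3,2)]) (rule Ck_lip_bound[OF Suc.prems(1)])
  moreover have "\<bar>(\<integral>s. f s x \<partial>M) - (\<integral>s. f s y \<partial>M)\<bar> \<le> (\<integral>s. b s \<partial>M) * norm (x - y)" for x y
  proof -
    have "\<bar>\<integral>s. f s x - f s y \<partial>M\<bar> \<le> (\<integral>s. b s * norm (x - y) \<partial>M)"
      by (rule integrable_dominated(2))
        (auto intro!: borel_measurable_diff Suc.prems(2,3) Ck_lip_lipschitz[OF Suc.prems(1)])
    then show ?thesis using int by simp
  qed
  moreover
  have "\<forall>s\<in>space M. \<exists>G. (\<forall>x. (f s has_derivative (\<lambda>v. G x \<bullet> v)) (at x)) \<and>
      (\<forall>i. Ck_lip k (b s) (\<lambda>x. G x $ i))"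
    using Suc.prems(1) by simp
  then obtain G where der: "\<And>s x. s \<in> space M \<Longrightarrow> (f s has_derivative (\<lambda>v. G s x \<bullet> v)) (at x)"
    and G: "\<And>s i. s \<in> space M \<Longrightarrow> Ck_lip k (b s) (\<lambda>x. G s x $ i)" by metis
  have taylor: "\<bar>f s (x + v) - f s x - G s x \<bullet> v\<bar> \<le> ?n * b s * (norm v)\<^sup>2"
    if "s \<in> space M" for s x v
    using Ck_lip_taylor[OF der G, OF that that] .
  have meas: "(\<lambda>s. G s x $ i) \<in> borel_measurable M" for x i
  proof (rule borel_measurable_LIMSEQ_real)
    fix s assume s: "s \<in> space M"
    let ?q = "\<lambda>m. (f s (x + inverse (real (Suc m)) *\<^sub>R axis i 1) - f s x) * real (Suc m)"
    show "?q \<longlonglongrightarrow> G s x $ i"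
    proof (rule LIMSEQ_I)
      fix e :: real assume e: "e > 0"
      have q: "norm (?q m - G s x $ i) \<le> ?n * b s * inverse (real (Suc m))" for m
      proof -
        let ?h = "inverse (real (Suc m))"
        have "\<bar>f s (x + ?h *\<^sub>R axis i 1) - f s x - ?h * G s x $ i\<bar> \<le> ?n * b s * ?h\<^sup>2"
          using taylor[OF s, of x "?h *\<^sub>R axis i 1"] by (simp add: inner_axis)
        then have "\<bar>f s (x + ?h *\<^sub>R axis i 1) - f s x - ?h * G s x $ i\<bar> * real (Suc m)
            \<le> ?n * b s * ?h\<^sup>2 * real (Suc m)" by (rule mult_right_mono) simp
        moreover have "?q m - G s x $ i =
            (f s (x + ?h *\<^sub>R axis i 1) - f s x - ?h * G s x $ i) * real (Suc m)"
          by (simp add: field_simps)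
        moreover have "?n * b s * ?h\<^sup>2 * real (Suc m) = ?n * b s * ?h"
          by (simp add: power2_eq_square mult.assoc del: of_nat_Suc)
        ultimately show ?thesis by (simp only: real_norm_def abs_mult abs_of_nat)
      qed
      have "(\<lambda>m. ?n * b s * inverse (real (Suc m))) \<longlonglongrightarrow> ?n * b s * 0"
        by (intro tendsto_intros LIMSEQ_inverse_real_of_nat)
      from LIMSEQ_D[OF this e] obtain N where
        N: "\<And>m. m \<ge> N \<Longrightarrow> norm (?n * b s * inverse (real (Suc m)) - ?n * b s * 0) < e" by blast
      have "norm (?q m - G s x $ i) < e" if "m \<ge> N" for m
        using q[of m] N[OF that] by (simp only: mult_zero_right diff_0_right real_norm_def)
      then show "\<exists>N. \<forall>m\<ge>N. norm (?q m - G s x $ i) < e" by blast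
    qed
  next
    show "(\<lambda>s. (f s (x + inverse (real (Suc m)) *\<^sub>R axis i 1) - f s x) * real (Suc m))
        \<in> borel_measurable M" for m
      by (intro borel_measurable_times borel_measurable_diff Suc.prems(2) borel_measurable_const)
  qed
  have Gint: "integrable M (\<lambda>s. G s x $ i)" for x i
    by (rule integrable_dominated(1)[OF Suc.prems(3) meas]) (rule Ck_lip_bound[OF G])
  define g where "g x = (\<chi> i. \<integral>s. G s x $ i \<partial>M)" for x
  have "Ck_lip k (\<integral>s. b s \<partial>M) (\<lambda>x. g x $ i)" for i
    using Suc.IH[OF G meas Suc.prems(3)] by (simp add: g_def)
  moreover have "((\<lambda>x. \<integral>s. f s x \<partial>M) has_derivative (\<lambda>v. g x \<bullet> v)) (at x)" for x
  proof (rule has_derivative_of_quadratic_error)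
    fix v
    have "\<bar>\<integral>s. f s (x + v) - f s x - G s x \<bullet> v \<partial>M\<bar> \<le> (\<integral>s. ?n * b s * (norm v)\<^sup>2 \<partial>M)"
      by (rule integrable_dominated(2))
        (use taylor Suc.prems(2,3) meas in \<open>auto simp: inner_vec_def\<close>)
    moreover have "(\<integral>s. f s (x + v) - f s x - G s x \<bullet> v \<partial>M) =
        (\<integral>s. f s (x + v) \<partial>M) - (\<integral>s. f s x \<partial>M) - g x \<bullet> v"
      using int Gint by (simp add: inner_vec_def g_def)
    ultimately show "\<bar>(\<integral>s. f s (x + v) \<partial>M) - (\<integral>s. f s x \<partial>M) - g x \<bullet> v\<bar>
        \<le> (?n * (\<integral>s. b s \<partial>M)) * (norm v)\<^sup>2"
      by simp
  qed
  ultimately show ?case by auto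
qed

section \<open>Functions and maps on the torus\<close>

lemma dist_to_torus_le: "dist (to_torus x) (to_torus y) \<le> norm (x - y)"
  by (rule dist_torus_le) (simp add: to_torus_diff)

lemma continuous_on_to_torus: "continuous_on S to_torus"
proof (rule continuous_onI)
  fix x and e :: real assume "e > 0"
  then show "\<exists>d>0. \<forall>x'\<in>S. dist x' x < d \<longrightarrow> dist (to_torus x') (to_torus x) \<le> e"
    by (intro exI[of _ e]) (auto simp: dist_norm intro: order_trans[OF dist_to_torus_le] less_imp_le)
qed

text \<open>Two points of the torus have lifts whose distance is arbitrarily close to the distance of
  the points.\<close>

lemma lipschitz_on_torus:
  fixes f :: "'n::finite torus \<Rightarrow> 'b::metric_space"
  assumes lip: "\<And>x y. dist (f (to_torus x)) (f (to_torus y)) \<le> L * norm (x - y)" and L: "0 \<le> L"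
  shows "dist (f p) (f q) \<le> L * dist p q"
proof (rule field_le_epsilon)
  fix e :: real assume e: "e > 0"
  obtain v where v: "to_torus v = p - q" "norm v < dist p q + e / (L + 1)"
    using dist_torus_less[of p q "dist p q + e / (L + 1)"] e L by auto
  obtain y where y: "to_torus y = q" using to_torus_surj by blast
  have p: "to_torus (y + v) = p" using v(1) y by (simp add: to_torus_add)
  have "dist (f p) (f q) \<le> L * norm v" using lip[of "y + v" y] p y by simp
  also have "\<dots> \<le> L * (dist p q + e / (L + 1))" using v(2) L by (intro mult_left_mono) auto
  also have "\<dots> \<le> L * dist p q + e" using e L by (simp add: field_simps)
  finally show "dist (f p) (f q) \<le> L * dist p q + e" .
qed

lemma compact_torus: "compact (UNIV :: 'n::finite torus set)"
proof -
  have "UNIV = to_torus ` cbox 0 (1 :: real ^ 'n)"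
  proof (intro equalityI subsetI)
    fix q :: "'n torus"
    obtain x where x: "to_torus x = q" using to_torus_surj by blast
    define y :: "real ^ 'n" where "y = (\<chi> i. frac (x $ i))"
    have "to_torus y = q"
      unfolding x[symmetric] to_torus_eq_iff by (simp add: y_def frac_def)
    moreover have "y \<in> cbox 0 1"
      by (auto simp: mem_box_cart y_def frac_lt_1 less_imp_le)
    ultimately show "q \<in> to_torus ` cbox 0 1" by blast
  qed auto
  then show ?thesis using compact_continuous_image[OF continuous_on_to_torus compact_cbox] by metis
qed

lemma torus_line_derivative:
  assumes "((\<lambda>x. f (to_torus x)) has_derivative (\<lambda>v. g \<bullet> v)) (at x)"
  shows "((\<lambda>s. f (to_torus x + to_torus (s *\<^sub>R axis i 1))) has_real_derivative g $ i) (at 0)"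
proof -
  have "((\<lambda>x. f (to_torus x)) has_derivative (\<lambda>v. g \<bullet> v)) (at (x + 0 *\<^sub>R axis i 1))"
    using assms by simp
  then have "((\<lambda>s. f (to_torus (x + s *\<^sub>R axis i 1))) has_derivative (\<lambda>s. g \<bullet> (s *\<^sub>R axis i 1))) (at 0)"
    by (rule has_derivative_compose[rotated]) (auto intro!: derivative_eq_intros)
  then show ?thesis
    by (simp add: has_field_derivative_def to_torus_add inner_axis mult.commute[of _ "g $ i"])
qed

lemma Ck_lip_torus_pderiv:
  assumes "Ck_lip (Suc k) B (\<lambda>x. f (to_torus x))"
  shows "Ck_lip k B (\<lambda>x. torus_pderiv i f (to_torus x))"
    and "(\<lambda>s. f (q + to_torus (s *\<^sub>R axis i 1))) differentiable (at (0::real))"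
proof -
  obtain G where G: "\<And>x. ((\<lambda>x. f (to_torus x)) has_derivative (\<lambda>v. G x \<bullet> v)) (at x)"
    "\<And>i. Ck_lip k B (\<lambda>x. G x $ i)" using Ck_lip_SucE[OF assms] by blast
  have "torus_pderiv i f (to_torus x) = G x $ i" for x
    unfolding torus_pderiv_def by (rule DERIV_imp_deriv[OF torus_line_derivative[OF G(1)]])
  then show "Ck_lip k B (\<lambda>x. torus_pderiv i f (to_torus x))" using G(2) by simp
  obtain x where "to_torus x = q" using to_torus_surj by blast
  then show "(\<lambda>s. f (q + to_torus (s *\<^sub>R axis i 1))) differentiable (at (0::real))"
    using torus_line_derivative[OF G(1)[of x], of i] real_differentiable_def by blast
qed

lemma Ck_lip_torus_pderivs:
  assumes "Ck_lip k B (\<lambda>x. f (to_torus x))" "length \<alpha> \<le> k"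
  shows "Ck_lip (k - length \<alpha>) B (\<lambda>x. torus_pderivs \<alpha> f (to_torus x))"
  using assms(2)
proof (induction \<alpha>)
  case Nil
  then show ?case using assms(1) by (simp add: torus_pderivs_def)
next
  case (Cons i \<alpha>)
  then have "Ck_lip (Suc (k - length (i # \<alpha>))) B (\<lambda>x. torus_pderivs \<alpha> f (to_torus x))"
    by (simp add: Suc_diff_Suc)
  from Ck_lip_torus_pderiv(1)[OF this] show ?case by (simp add: torus_pderivs_def)
qed

lemma torus_pderivs_bounds:
  fixes f :: "'n::finite torus \<Rightarrow> real"
  assumes "Ck_lip k B (\<lambda>x. f (to_torus x))" "length \<alpha> \<le> k"
  shows "\<bar>torus_pderivs \<alpha> f q\<bar> \<le> B"
    and "\<bar>torus_pderivs \<alpha> f p - torus_pderivs \<alpha> f q\<bar> \<le> B * dist p q"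
proof -
  note C = Ck_lip_torus_pderivs[OF assms]
  obtain x where "to_torus x = q" using to_torus_surj by blast
  then show "\<bar>torus_pderivs \<alpha> f q\<bar> \<le> B" using Ck_lip_bound[OF C, of x] by simp
  show "\<bar>torus_pderivs \<alpha> f p - torus_pderivs \<alpha> f q\<bar> \<le> B * dist p q"
    using lipschitz_on_torus[of "torus_pderivs \<alpha> f" B p q] Ck_lip_lipschitz[OF C] Ck_lip_nonneg[OF C]
    by (simp add: dist_real_def)
qed

lemma torus_Ck_of_Ck_lip:
  fixes f :: "'n::finite torus \<Rightarrow> real"
  assumes "Ck_lip k B (\<lambda>x. f (to_torus x))"
  shows "torus_Ck k f"
  unfolding torus_Ck_def
proof (intro conjI allI impI)
  fix \<alpha> :: "'n list" assume \<alpha>: "length \<alpha> \<le> k"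
  have "B-lipschitz_on UNIV (torus_pderivs \<alpha> f)"
    using torus_pderivs_bounds(2)[OF assms \<alpha>] Ck_lip_nonneg[OF assms]
    by (intro lipschitz_onI) (auto simp: dist_real_def)
  then show "continuous_on UNIV (torus_pderivs \<alpha> f)" by (rule lipschitz_on_continuous_on)
next
  fix \<alpha> :: "'n list" and i q assume \<alpha>: "length \<alpha> < k"
  then have "Ck_lip (Suc (k - length \<alpha> - 1)) B (\<lambda>x. torus_pderivs \<alpha> f (to_torus x))"
    using Ck_lip_torus_pderivs[OF assms, of \<alpha>] by (simp add: Suc_diff_Suc)
  then show "(\<lambda>s. torus_pderivs \<alpha> f (q + to_torus (s *\<^sub>R axis i 1))) differentiable (at (0::real))"
    by (rule Ck_lip_torus_pderiv(2))
qed

text \<open>For the Hoelder quotient of exponent \<open>\<mu> < 1\<close>, points at distance at most 1 are handled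
  by the Lipschitz bound and points further apart by the sup bound, which gives \<open>2 B\<close>; the third
  \<open>B\<close> bounds the derivatives.\<close>

lemma holder_norm_le:
  fixes f :: "'n::finite torus \<Rightarrow> real"
  assumes f: "Ck_lip (nat \<lfloor>\<sigma>\<rfloor>) B (\<lambda>x. f (to_torus x))"
  shows "holder_norm \<sigma> f \<le> ennreal (3 * B)"
proof -
  define k where "k = nat \<lfloor>\<sigma>\<rfloor>"
  have B: "0 \<le> B" using f by (rule Ck_lip_nonneg)
  have f: "Ck_lip k B (\<lambda>x. f (to_torus x))" using f by (simp add: k_def)
  have 1: "(SUP \<alpha>\<in>{\<alpha>. length \<alpha> \<le> k}. SUP q. ennreal \<bar>torus_pderivs \<alpha> f q\<bar>) \<le> ennreal B"
    by (intro SUP_least ennreal_leI) (auto intro: torus_pderivs_bounds(1)[OF f])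
  have 2: "(SUP \<alpha>\<in>{\<alpha>. length \<alpha> = k}. SUP (p, q)\<in>{(p, q). p \<noteq> q}.
          ennreal (\<bar>torus_pderivs \<alpha> f p - torus_pderivs \<alpha> f q\<bar> / dist p q powr frac \<sigma>)) \<le> ennreal (2 * B)"
  proof (rule SUP_least, rule SUP_least)
    fix \<alpha> :: "'n list" and z :: "'n torus \<times> 'n torus"
    assume "\<alpha> \<in> {\<alpha>. length \<alpha> = k}" "z \<in> {(p, q). p \<noteq> q}"
    then obtain p q where \<alpha>: "length \<alpha> = k" and z: "z = (p, q)" and pq: "p \<noteq> q" by auto
    let ?d = "dist p q"
    have d: "?d > 0" using pq by simp
    have \<mu>: "0 \<le> frac \<sigma>" "frac \<sigma> < 1" by (auto simp: frac_lt_1)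
    have "\<bar>torus_pderivs \<alpha> f p - torus_pderivs \<alpha> f q\<bar> \<le> 2 * B * ?d powr frac \<sigma>"
    proof (cases "?d \<le> 1")
      case True
      have "?d = ?d powr 1" using d by simp
      also have "\<dots> \<le> ?d powr frac \<sigma>" using True d \<mu> by (intro powr_mono') auto
      finally have "B * ?d \<le> B * ?d powr frac \<sigma>" using B by (rule mult_left_mono)
      moreover have "0 \<le> B * ?d powr frac \<sigma>" using B by simp
      ultimately show ?thesis
        using torus_pderivs_bounds(2)[OF f, of \<alpha> p q] \<alpha> by linarith
    next
      case False
      then have "1 \<le> ?d powr frac \<sigma>" using \<mu> by (intro ge_one_powr_ge_zero) auto
      then have "2 * B * 1 \<le> 2 * B * ?d powr frac \<sigma>" using B by (intro mult_left_mono) auto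
      then show ?thesis
        using torus_pderivs_bounds(1)[OF f, of \<alpha> p] torus_pderivs_bounds(1)[OF f, of \<alpha> q] \<alpha> by linarith
    qed
    then show "(case z of (p, q) \<Rightarrow> ennreal (\<bar>torus_pderivs \<alpha> f p - torus_pderivs \<alpha> f q\<bar> /
        dist p q powr frac \<sigma>)) \<le> ennreal (2 * B)"
      using d by (simp add: z divide_le_eq ennreal_leI)
  qed
  have "holder_norm \<sigma> f \<le> ennreal B + ennreal (2 * B)"
    unfolding holder_norm_def Let_def k_def[symmetric] using 1 2 by (simp add: add_mono)
  also have "\<dots> = ennreal (3 * B)" using B by (simp flip: ennreal_plus)
  finally show ?thesis .
qed

lemma holder_class_of_Ck_lip:
  "Ck_lip (nat \<lfloor>\<sigma>\<rfloor>) B (\<lambda>x. f (to_torus x)) \<Longrightarrow> holder_class \<sigma> f"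
  unfolding holder_class_def
  using torus_Ck_of_Ck_lip holder_norm_le le_less_trans[OF _ ennreal_less_top] by fastforce

lemma holder_norm_vec_le:
  fixes f :: "'n::finite torus \<Rightarrow> real ^ 'm::finite"
  assumes "\<And>j. Ck_lip (nat \<lfloor>\<sigma>\<rfloor>) B (\<lambda>x. f (to_torus x) $ j)"
  shows "holder_norm_vec \<sigma> f \<le> ennreal (3 * B)"
  unfolding holder_norm_vec_def using holder_norm_le[OF assms] by (subst Max_le_iff) auto

lemma abs_torus_pderivs_le_holder_norm_vec:
  fixes f :: "'n::finite torus \<Rightarrow> real ^ 'm::finite"
  assumes "holder_norm_vec \<sigma> f \<le> ennreal b" "0 \<le> b" "length \<alpha> \<le> nat \<lfloor>\<sigma>\<rfloor>"
  shows "\<bar>torus_pderivs \<alpha> (\<lambda>q. f q $ j) q\<bar> \<le> b"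
proof -
  have "ennreal \<bar>torus_pderivs \<alpha> (\<lambda>q. f q $ j) q\<bar> \<le>
      (SUP \<alpha>\<in>{\<alpha>. length \<alpha> \<le> nat \<lfloor>\<sigma>\<rfloor>}. SUP q. ennreal \<bar>torus_pderivs \<alpha> (\<lambda>q. f q $ j) q\<bar>)"
    using assms(3) by (intro SUP_upper2[of \<alpha>] SUP_upper2[of q]) auto
  also have "\<dots> \<le> holder_norm \<sigma> (\<lambda>q. f q $ j)"
    unfolding holder_norm_def Let_def by (rule add_increasing2) auto
  also have "\<dots> \<le> holder_norm_vec \<sigma> f" unfolding holder_norm_vec_def by (rule Max_ge) auto
  also note assms(1)
  finally show ?thesis using assms(2) by simp
qed

text \<open>One derivative is given up: bounds on the derivatives of order \<open>k + 1\<close> provide the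
  Lipschitz constants of those of order \<open>k\<close>, at the cost of the dimension as a factor.\<close>

lemma Ck_lip_of_torus_Ck:
  fixes f :: "'n::finite torus \<Rightarrow> real"
  assumes "torus_Ck (Suc k) f" "\<And>\<alpha> q. length \<alpha> \<le> Suc k \<Longrightarrow> \<bar>torus_pderivs \<alpha> f q\<bar> \<le> b"
  shows "Ck_lip k (real CARD('n) * b) (\<lambda>x. f (to_torus x))"
  using assms
proof (induction k arbitrary: f)
  have *: "\<bar>f (to_torus x)\<bar> \<le> real CARD('n) * b"
    "\<bar>f (to_torus x) - f (to_torus y)\<bar> \<le> real CARD('n) * b * norm (x - y)"
    "((\<lambda>x. f (to_torus x)) has_derivative (\<lambda>v. (\<chi> i. torus_pderiv i f (to_torus x)) \<bullet> v)) (at x)"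
    if C: "torus_Ck (Suc k) f" and b: "\<And>\<alpha> q. length \<alpha> \<le> Suc k \<Longrightarrow> \<bar>torus_pderivs \<alpha> f q\<bar> \<le> b"
    for f :: "'n torus \<Rightarrow> real" and k x y
  proof -
    have fb: "\<bar>f q\<bar> \<le> b" for q using b[of "[]" q] by (simp add: torus_pderivs_def)
    then have "0 \<le> b" using abs_ge_zero order_trans by blast
    then have "1 * b \<le> real CARD('n) * b" by (intro mult_right_mono) auto
    then show "\<bar>f (to_torus x)\<bar> \<le> real CARD('n) * b" using fb[of "to_torus x"] by linarith
    have partial: "((\<lambda>s. f (to_torus (x + s *\<^sub>R axis i 1))) has_real_derivative
        torus_pderiv i f (to_torus x)) (at 0)" for x i
    proof -
      have "(\<lambda>s. f (to_torus x + to_torus (s *\<^sub>R axis i 1))) differentiable (at (0::real))"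
        using C unfolding torus_Ck_def by (auto simp: torus_pderivs_def dest!: spec[of _ "[]"])
      then show ?thesis
        unfolding torus_pderiv_def to_torus_add
        by (metis DERIV_deriv_iff_real_differentiable)
    qed
    have "continuous_on UNIV (torus_pderiv i f)" for i
      using C[unfolded torus_Ck_def, THEN conjunct1, rule_format, of "[i]"]
      by (simp add: torus_pderivs_def)
    then have "continuous_on UNIV (\<lambda>x. torus_pderiv i f (to_torus x))" for i
      using continuous_on_compose2[OF _ continuous_on_to_torus] by blast
    then show der: "((\<lambda>x. f (to_torus x)) has_derivative
        (\<lambda>v. (\<chi> i. torus_pderiv i f (to_torus x)) \<bullet> v)) (at x)" for x
      using partial by (intro has_derivative_of_continuous_partials) auto
    have "\<bar>torus_pderiv i f q\<bar> \<le> b" for i q using b[of "[i]" q] by (simp add: torus_pderivs_def)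
    then show "\<bar>f (to_torus x) - f (to_torus y)\<bar> \<le> real CARD('n) * b * norm (x - y)"
      by (intro lipschitz_of_gradient_bound[OF der]) simp
  qed
  {
    case 0
    then show ?case using *[OF 0] by simp
  next
    case (Suc k)
    have app: "torus_pderivs \<alpha> (torus_pderiv i f) = torus_pderivs (\<alpha> @ [i]) f" for \<alpha> i
      by (simp add: torus_pderivs_def)
    have "torus_Ck (Suc k) (torus_pderiv i f)" for i
      using Suc.prems(1) unfolding torus_Ck_def app by simp
    then have "Ck_lip k (real CARD('n) * b) (\<lambda>x. torus_pderiv i f (to_torus x))" for i
      using Suc.prems(2) by (intro Suc.IH) (auto simp: app)
    then show ?case using *[OF Suc.prems]
      by (intro Ck_lip_SucI[where G = "\<lambda>x. \<chi> i. torus_pderiv i f (to_torus x)"]) auto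
  }
qed

text \<open>The square of the dimension enters through the passage from bounds on the entries of the
  Jacobian to its operator norm.\<close>

lemma torus_displacement:
  fixes u :: "'n::finite torus \<Rightarrow> real ^ 'n"
  assumes u: "\<And>j. Ck_lip (Suc k) B (\<lambda>x. u (to_torus x) $ j)"
    and B: "real CARD('n) * (real CARD('n) * B) \<le> 1 / 2"
  shows lipschitz_displacement: "norm (u (to_torus x) - u (to_torus y)) \<le> 1 / 2 * norm (x - y)"
    and derivative_displacement:
      "\<exists>D. ((\<lambda>x. u (to_torus x)) has_derivative D) (at x) \<and> (\<forall>v. norm (D v) \<le> 1 / 2 * norm v)"
proof -
  let ?n = "real CARD('n)"
  have B0: "0 \<le> B" using u by (rule Ck_lip_nonneg)
  have "1 * (?n * B) \<le> ?n * (?n * B)" using B0 by (intro mult_right_mono) auto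
  then have nB: "?n * B \<le> 1 / 2" using B by linarith
  have "norm (u (to_torus x) - u (to_torus y)) \<le> ?n * (B * norm (x - y))"
    using Ck_lip_lipschitz[OF u] by (intro norm_le_card) simp
  also have "\<dots> \<le> 1 / 2 * norm (x - y)"
    using mult_right_mono[OF nB, of "norm (x - y)"] by (simp add: mult.assoc)
  finally show "norm (u (to_torus x) - u (to_torus y)) \<le> 1 / 2 * norm (x - y)" .
  have "\<forall>j. \<exists>W. (\<forall>x. ((\<lambda>x. u (to_torus x) $ j) has_derivative (\<lambda>v. W x \<bullet> v)) (at x)) \<and>
      (\<forall>i. Ck_lip k B (\<lambda>x. W x $ i))"
    using u by simp
  then obtain W where W: "\<And>j x. ((\<lambda>x. u (to_torus x) $ j) has_derivative (\<lambda>v. W j x \<bullet> v)) (at x)"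
    "\<And>j i. Ck_lip k B (\<lambda>x. W j x $ i)" by metis
  have "((\<lambda>x. u (to_torus x)) has_derivative (\<lambda>v. \<chi> j. W j x \<bullet> v)) (at x)"
    by (rule has_derivative_vecI) (simp add: W)
  moreover have "norm (\<chi> j. W j x \<bullet> v) \<le> 1 / 2 * norm v" for v
  proof -
    have "norm (\<chi> j. W j x \<bullet> v) \<le> ?n * (?n * B * norm v)"
      using abs_inner_le_sum[OF Ck_lip_bound[OF W(2)]] by (intro norm_le_card) simp
    also have "\<dots> \<le> 1 / 2 * norm v"
      using mult_right_mono[OF B, of "norm v"] by (simp add: mult.assoc)
    finally show ?thesis .
  qed
  ultimately show "\<exists>D. ((\<lambda>x. u (to_torus x)) has_derivative D) (at x) \<and>
      (\<forall>v. norm (D v) \<le> 1 / 2 * norm v)" by blast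
qed

lemma torus_has_derivative_displacement:
  assumes "((\<lambda>x. u (to_torus x)) has_derivative D) (at x)"
  shows "torus_has_derivative (\<lambda>q. q + to_torus (u q)) (\<lambda>v. v + D v) (to_torus x)"
  unfolding torus_has_derivative_def
proof (intro exI conjI allI)
  let ?F = "\<lambda>v. (x + v) + u (to_torus (x + v))"
  show "to_torus (?F v) = to_torus x + to_torus v + to_torus (u (to_torus x + to_torus v))" for v
    by (simp add: to_torus_add)
  have "((\<lambda>x. u (to_torus x)) has_derivative D) (at (x + 0))" using assms by simp
  then have "((\<lambda>v. u (to_torus (x + v))) has_derivative D) (at 0)"
    by (rule has_derivative_compose[rotated]) (auto intro!: derivative_eq_intros)
  then show "(?F has_derivative (\<lambda>v. v + D v)) (at 0)"
    by (auto intro!: derivative_eq_intros)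
qed

text \<open>The identity plus a contraction is injective with injective derivative, and a continuous
  injection of the compact torus is an embedding.\<close>

lemma torus_embedding_displacement:
  fixes u :: "'n::finite torus \<Rightarrow> real ^ 'n"
  assumes \<sigma>: "\<sigma> \<ge> 1"
    and u: "\<And>j. Ck_lip (nat \<lfloor>\<sigma>\<rfloor>) B (\<lambda>x. u (to_torus x) $ j)"
    and B: "real CARD('n) * (real CARD('n) * B) \<le> 1 / 2"
  shows "torus_embedding \<sigma> (\<lambda>q. q + to_torus (u q))"
proof -
  let ?\<psi> = "\<lambda>q. q + to_torus (u q)"
  obtain k where k: "nat \<lfloor>\<sigma>\<rfloor> = Suc k" using \<sigma> by (cases "nat \<lfloor>\<sigma>\<rfloor>") linarith+
  note lip = lipschitz_displacement[OF u[unfolded k] B]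
  note der = derivative_displacement[OF u[unfolded k] B]
  have "torus_map_class \<sigma> ?\<psi>"
    unfolding torus_map_class_def
  proof (intro exI[of _ "mat 1"] exI[of _ u] conjI allI)
    show "(mat 1 :: real ^ 'n ^ 'n) $ i $ j \<in> \<int>" for i j by (simp add: mat_def)
    show "holder_class_vec \<sigma> u"
      unfolding holder_class_vec_def using holder_class_of_Ck_lip[OF u] by blast
  qed (simp add: to_torus_add)
  moreover have "\<exists>D. torus_has_derivative ?\<psi> D q \<and> inj D" for q
  proof -
    obtain x where x: "to_torus x = q" using to_torus_surj by blast
    obtain D where D: "((\<lambda>x. u (to_torus x)) has_derivative D) (at x)"
      "\<And>v. norm (D v) \<le> 1 / 2 * norm v" using der by blast
    have lin: "linear (\<lambda>v. v + D v)"
      by (intro linear_compose_add linear_id[unfolded id_def] has_derivative_linear[OF D(1)])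
    have "inj (\<lambda>v. v + D v)"
      unfolding linear_injective_0[OF lin]
    proof (intro allI impI)
      fix v assume "v + D v = 0"
      then have "norm (D v) = norm v" by (metis add_eq_0_iff norm_minus_cancel)
      then have "norm v \<le> 0" using D(2)[of v] by simp
      then show "v = 0" by simp
    qed
    then show ?thesis using torus_has_derivative_displacement[OF D(1)] x by blast
  qed
  moreover have "embedding_map euclidean euclidean ?\<psi>"
  proof (rule continuous_imp_embedding_map)
    have "dist (?\<psi> p) (?\<psi> q) \<le> 2 * dist p q" for p q
    proof (rule lipschitz_on_torus)
      fix x y :: "real ^ 'n"
      have "dist (?\<psi> (to_torus x)) (?\<psi> (to_torus y)) \<le>
          norm ((x + u (to_torus x)) - (y + u (to_torus y)))"
        using dist_to_torus_le by (metis to_torus_add)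
      also have "\<dots> \<le> 2 * norm (x - y)"
      proof -
        have "norm ((x - y) + (u (to_torus x) - u (to_torus y))) \<le> norm (x - y) + 1 / 2 * norm (x - y)"
          using norm_triangle_ineq lip[of x y] by (rule order_trans[OF _ add_left_mono])
        also have "\<dots> \<le> 2 * norm (x - y)" by simp
        finally show ?thesis by (simp add: algebra_simps)
      qed
      finally show "dist (?\<psi> (to_torus x)) (?\<psi> (to_torus y)) \<le> 2 * norm (x - y)" .
    qed simp
    then have "2-lipschitz_on UNIV ?\<psi>" by (intro lipschitz_onI) auto
    then show "continuous_map euclidean euclidean ?\<psi>"
      using lipschitz_on_continuous_on continuous_map_iff_continuous2 by blast
    show "compact_space (euclidean :: 'n torus topology)"
      using compact_torus by (simp add: compact_space_def)
    show "Hausdorff_space (euclidean :: 'n torus topology)" by simp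
    show "inj_on ?\<psi> (topspace euclidean)"
    proof (rule inj_onI)
      fix p q assume pq: "?\<psi> p = ?\<psi> q"
      obtain x where x: "to_torus x = p" using to_torus_surj by blast
      obtain y where y: "to_torus y = q" using to_torus_surj by blast
      let ?m = "(x + u p) - (y + u q)"
      have "to_torus ?m = 0" using pq x y by (simp add: to_torus_add to_torus_diff)
      then have y': "to_torus (y + ?m) = q" using y to_torus_add[of y ?m] by simp
      \<comment> \<open>Equality on the torus means equality of lifts up to the integer vector \<open>?m\<close>; moving the
        lift of \<open>q\<close> by it turns the hypothesis into an equation in the covering space.\<close>
      have "x - (y + ?m) = u q - u p" by simp
      then have "norm (x - (y + ?m)) \<le> 1 / 2 * norm (x - (y + ?m))"
        using lip[of x "y + ?m"] x y' by (metis norm_minus_commute)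
      then have "norm (x - (y + ?m)) \<le> 0" by linarith
      then have "x = y + ?m" by simp
      then show "p = q" using x y' by metis
    qed
  qed
  ultimately show ?thesis unfolding torus_embedding_def by blast
qed

section \<open>Integrals up to infinity\<close>

lemma tail_integral_split:
  fixes g :: "real \<Rightarrow> real"
  assumes "set_integrable lborel {a..} g" "a \<le> t"
  shows "(LINT s:{t..}|lborel. g s) = (LINT s:{a..}|lborel. g s) - integral {a..t} g"
proof -
  have 1: "set_integrable lborel {t..} g" and 2: "set_integrable lborel {a..t} g"
    using assms by (auto intro: set_integrable_subset[OF assms(1)])
  have "{a..} = {a..t} \<union> {t..}" "{a..t} \<inter> {t..} = {t}" using assms(2) by auto
  then have "integral {a..} g = integral {a..t} g + integral {t..} g"
    using integral_Un[of g "{a..t}" "{t..}"] set_borel_integral_eq_integral(1)[OF 1]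
      set_borel_integral_eq_integral(1)[OF 2] by simp
  then show ?thesis
    using set_borel_integral_eq_integral(2)[OF 1] set_borel_integral_eq_integral(2)[OF assms(1)]
    by simp
qed

lemma tail_integral_tendsto_0:
  fixes g :: "real \<Rightarrow> real"
  assumes g: "set_integrable lborel {a..} g"
  shows "((\<lambda>t. LINT s:{t..}|lborel. g s) \<longlongrightarrow> 0) at_top"
proof -
  have "((\<lambda>t. LINT s:{a..t}|lborel. g s) \<longlongrightarrow> (LINT s:{a..}|lborel. g s)) at_top"
    by (rule tendsto_set_lebesgue_integral_at_top[OF _ g]) simp
  then have "((\<lambda>t. (LINT s:{a..}|lborel. g s) - (LINT s:{a..t}|lborel. g s)) \<longlongrightarrow>
      (LINT s:{a..}|lborel. g s) - (LINT s:{a..}|lborel. g s)) at_top"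
    by (intro tendsto_diff tendsto_const)
  then have "((\<lambda>t. (LINT s:{a..}|lborel. g s) - (LINT s:{a..t}|lborel. g s)) \<longlongrightarrow> 0) at_top"
    by simp
  moreover have "\<forall>\<^sub>F t in at_top. (LINT s:{a..}|lborel. g s) - (LINT s:{a..t}|lborel. g s)
      = (LINT s:{t..}|lborel. g s)"
    using eventually_ge_at_top[of a]
  proof eventually_elim
    case (elim t)
    have "set_integrable lborel {a..t} g" by (rule set_integrable_subset[OF g]) auto
    then show ?case
      using tail_integral_split[OF g elim] by (simp add: set_borel_integral_eq_integral(2))
  qed
  ultimately show ?thesis by (rule Lim_transform_eventually)
qed

lemma tail_integral_antimono:
  fixes g :: "real \<Rightarrow> real"
  assumes "set_integrable lborel {a..} g" "\<And>s. s \<ge> a \<Longrightarrow> 0 \<le> g s" "a \<le> t" "t \<le> t'"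
  shows "(LINT s:{t'..}|lborel. g s) \<le> (LINT s:{t..}|lborel. g s)"
proof -
  have g: "set_integrable lborel {t..} g"
    by (rule set_integrable_subset[OF assms(1)]) (use assms(3) in auto)
  have "set_integrable lborel {t..t'} g" by (rule set_integrable_subset[OF g]) auto
  then have "g integrable_on {t..t'}" by (rule set_borel_integral_eq_integral(1))
  then have "0 \<le> integral {t..t'} g"
    by (rule Henstock_Kurzweil_Integration.integral_nonneg) (use assms(2,3) in auto)
  then show ?thesis using tail_integral_split[OF g assms(4)] by simp
qed

lemma antimono_le_tail_integral:
  fixes b :: "real \<Rightarrow> real"
  assumes "set_integrable lborel {a..} b" "antimono_on {a..} b" "\<And>s. s \<ge> a \<Longrightarrow> 0 \<le> b s" "a \<le> t"
  shows "b (t + 1) \<le> (LINT s:{t..}|lborel. b s)"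
proof -
  have b: "set_integrable lborel {t..} b"
    by (rule set_integrable_subset[OF assms(1)]) (use assms(4) in auto)
  have "set_integrable lborel {t..t + 1} b"
    by (rule set_integrable_subset[OF b]) auto
  then have "b integrable_on {t..t + 1}" by (rule set_borel_integral_eq_integral(1))
  moreover have "b (t + 1) \<le> b s" if "s \<in> {t..t + 1}" for s
    using assms(2,4) that by (auto simp: monotone_on_def)
  ultimately have "integral {t..t + 1} (\<lambda>s. b (t + 1)) \<le> integral {t..t + 1} b"
    by (intro integral_le) auto
  moreover have "0 \<le> (LINT s:{t + 1..}|lborel. b s)"
    unfolding set_lebesgue_integral_def
    by (rule Bochner_Integration.integral_nonneg) (use assms(3,4) in \<open>auto simp: indicator_def\<close>)
  ultimately show ?thesis using tail_integral_split[OF b, of "t + 1"] by simp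
qed

lemma Ck_lip_tail_integral:
  fixes g :: "real ^ 'n \<Rightarrow> real \<Rightarrow> real"
  assumes cont: "\<And>x. continuous_on {t..} (g x)"
    and g: "\<And>s. s \<ge> t \<Longrightarrow> Ck_lip k (b s) (\<lambda>x. g x s)"
    and b: "set_integrable lborel {t..} b"
  shows "Ck_lip k (LINT s:{t..}|lborel. b s) (\<lambda>x. LINT s:{t..}|lborel. g x s)"
    and "set_integrable lborel {t..} (g x)"
proof -
  have meas: "(\<lambda>s. indicator {t..} s *\<^sub>R g x s) \<in> borel_measurable lborel" for x
    using borel_measurable_continuous_on_indicator[OF _ cont] by simp
  have *: "Ck_lip k (indicator {t..} s *\<^sub>R b s) (\<lambda>x. indicator {t..} s *\<^sub>R g x s)" for s
    using g by (auto simp: indicator_def intro: Ck_lip_const)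
  show "Ck_lip k (LINT s:{t..}|lborel. b s) (\<lambda>x. LINT s:{t..}|lborel. g x s)"
    unfolding set_lebesgue_integral_def
    by (rule Ck_lip_integral[OF * meas b[unfolded set_integrable_def]])
  show "set_integrable lborel {t..} (g x)"
    unfolding set_integrable_def
    by (rule integrable_dominated(1)[OF b[unfolded set_integrable_def] meas]) (rule Ck_lip_bound[OF *])
qed

lemma tail_integral_has_derivative:
  fixes g :: "real \<Rightarrow> real"
  assumes "set_integrable lborel {a..} g" "continuous_on {a..} g" "a \<le> t"
  shows "((\<lambda>t. LINT s:{t..}|lborel. g s) has_real_derivative - g t) (at t within {a..})"
proof -
  have "continuous_on {a..t + 1} g" by (rule continuous_on_subset[OF assms(2)]) auto
  then have "((\<lambda>t. integral {a..t} g) has_vector_derivative g t) (at t within {a..t + 1})"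
    using assms(3) by (intro integral_has_vector_derivative) auto
  moreover have "at t within {a..t + 1} = at t within {a..}"
    by (rule at_within_nhd[of t "{..<t + 1}"]) auto
  ultimately have "((\<lambda>t. integral {a..t} g) has_real_derivative g t) (at t within {a..})"
    by (simp add: has_real_derivative_iff_has_vector_derivative)
  from DERIV_diff[OF DERIV_const this]
  have "((\<lambda>t. (LINT s:{a..}|lborel. g s) - integral {a..t} g) has_real_derivative - g t)
      (at t within {a..})" by simp
  then show ?thesis
    by (rule has_field_derivative_transform_within[where d = 1])
      (use assms(3) in \<open>auto intro!: tail_integral_split[OF assms(1), symmetric]\<close>)
qed

text \<open>Lipschitz continuity in each variable, uniformly in the other one, gives joint Lipschitz
  continuity.\<close>

lemma continuous_on_pointwise_lipschitz:
  fixes w :: "(real ^ 'n) \<times> real \<Rightarrow> real ^ 'm"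
  assumes "\<And>x y t j. \<bar>w (x, t) $ j - w (y, t) $ j\<bar> \<le> L * norm (x - y)"
    and "\<And>x t t' j. \<bar>w (x, t) $ j - w (x, t') $ j\<bar> \<le> K * \<bar>t - t'\<bar>"
  shows "continuous_on UNIV w"
proof -
  have "0 \<le> L * norm (axis undefined 1 :: real ^ 'n)"
    using order_trans[OF abs_ge_zero assms(1)[of "axis undefined 1" _ _ 0]] by simp
  then have L: "0 \<le> L" by simp
  have "0 \<le> K * \<bar>1 - 0\<bar>" by (rule order_trans[OF abs_ge_zero assms(2)])
  then have K: "0 \<le> K" by simp
  have "dist (w p) (w q) \<le> real CARD('m) * (L + K) * dist p q" for p q
  proof -
    obtain x t y t' where pq: "p = (x, t)" "q = (y, t')" by (metis surj_pair)
    have "\<bar>(w p - w q) $ j\<bar> \<le> (L + K) * dist p q" for j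
    proof -
      have "\<bar>(w p - w q) $ j\<bar> \<le> L * norm (x - y) + K * \<bar>t - t'\<bar>"
        using assms(1)[of x t j y] assms(2)[of y t j t'] by (simp add: pq)
      also have "\<dots> \<le> L * dist p q + K * dist p q"
        using L K dist_fst_le[of p q] dist_snd_le[of p q]
        by (intro add_mono mult_left_mono) (auto simp: pq dist_norm)
      finally show ?thesis by (simp add: algebra_simps)
    qed
    then show ?thesis using norm_le_card[of "w p - w q"] by (simp add: dist_norm mult.assoc)
  qed
  then have "(real CARD('m) * (L + K))-lipschitz_on UNIV w"
    using L K by (intro lipschitz_onI) auto
  then show ?thesis by (rule lipschitz_on_continuous_on)
qed

section \<open>Solutions that vanish at infinity\<close>

text \<open>Banach's fixed point theorem for the integral operator \<open>F\<close> in the bounded continuous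
  functions of \<open>(x, t)\<close> with the uniform norm, on the set \<open>S\<close> of periodic functions whose slices
  lie in the balls of radius \<open>\<beta> t\<close>.  One factor of the dimension in the choice of \<open>T\<close> pays for
  the passage from components to the norm; since then \<open>\<beta> t \<le> 1\<close>, elements of \<open>S\<close> are small
  enough for the composition estimate, which maps \<open>S\<close> back into itself with the same \<open>\<beta>\<close>.\<close>

theorem solution_vanishing_at_infinity:
  fixes Q :: "real ^ 'n \<Rightarrow> real \<Rightarrow> real ^ 'n" and b :: "real \<Rightarrow> real"
  assumes contQ: "continuous_on (UNIV \<times> {0..}) (\<lambda>(x, t). Q x t)"
    and Q: "\<And>t j. t \<ge> 0 \<Longrightarrow> Ck_lip k (b t) (\<lambda>x. Q x t $ j)"
    and per: "\<And>x y t. (\<And>i. x $ i - y $ i \<in> \<int>) \<Longrightarrow> Q x t = Q y t"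
    and b: "set_integrable lborel {0..} b" "antimono_on {0..} b"
    and e: "e > 0"
  obtains T w \<beta> where "T \<ge> 0"
    and "\<And>t j. t \<ge> T \<Longrightarrow> Ck_lip k (\<beta> t) (\<lambda>x. w x t $ j)"
    and "\<And>t. t \<ge> T \<Longrightarrow> \<beta> t \<le> e" and "(\<beta> \<longlongrightarrow> 0) at_top"
    and "\<And>x y t. (\<And>i. x $ i - y $ i \<in> \<int>) \<Longrightarrow> w x t = w y t"
    and "continuous_on UNIV (\<lambda>(x, t). w x t)"
    and "\<And>x t. t \<ge> T \<Longrightarrow>
      ((\<lambda>t. w x t) has_vector_derivative Q (x + w x t) t) (at t within {T..})"
proof -
  let ?n = "real CARD('n)"
  have n1: "?n \<ge> 1" by simp
  obtain C where C1: "C \<ge> 1" and C: "\<And>(q :: real ^ 'n \<Rightarrow> real) B w. Ck_lip k B q \<Longrightarrow>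
     (\<And>j. Ck_lip k 1 (\<lambda>x. w x $ j)) \<Longrightarrow> Ck_lip k (C * B) (\<lambda>x. q (x + w x))"
    using Ck_lip_compose_near_id by metis
  define tail where "tail t = (LINT s:{t..}|lborel. b s)" for t
  define \<beta> where "\<beta> t = C * tail t" for t
  have b0: "0 \<le> b s" if "s \<ge> 0" for s using Q[OF that] by (rule Ck_lip_nonneg)
  have b_t: "set_integrable lborel {t..} b" if "t \<ge> 0" for t
    by (rule set_integrable_subset[OF b(1)]) (use that in auto)
  have \<beta>_lim: "(\<beta> \<longlongrightarrow> 0) at_top"
    unfolding \<beta>_def tail_def by (rule tendsto_mult_right_zero[OF tail_integral_tendsto_0[OF b(1)]])
  define \<delta> where "\<delta> = min e (1 / (2 * ?n))"
  have "\<delta> > 0" using e by (simp add: \<delta>_def)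
  then have "\<forall>\<^sub>F t in at_top. \<beta> t < \<delta> \<and> t \<ge> 0"
    using order_tendstoD(2)[OF \<beta>_lim] eventually_ge_at_top[of 0] by (intro eventually_conj) auto
  then obtain T where T0: "T \<ge> 0" and \<beta>T: "\<beta> T < \<delta>"
    unfolding eventually_at_top_linorder by blast
  have tail0: "0 \<le> tail t" if "t \<ge> 0" for t
    unfolding tail_def set_lebesgue_integral_def
    by (rule Bochner_Integration.integral_nonneg) (use b0 that in \<open>auto simp: indicator_def\<close>)
  have \<beta>0: "0 \<le> \<beta> t" if "t \<ge> T" for t using tail0[of t] C1 T0 that by (simp add: \<beta>_def)
  have tail_mono: "tail t \<le> tail T" if "t \<ge> T" for t
    unfolding tail_def using tail_integral_antimono[OF b(1) b0 T0 that] .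
  have \<beta>\<delta>: "\<beta> t \<le> \<delta>" if "t \<ge> T" for t
  proof -
    have "C * tail t \<le> C * tail T" using C1 tail_mono[OF that] by (intro mult_left_mono) auto
    then show ?thesis using \<beta>T by (simp add: \<beta>_def)
  qed
  have "1 / (2 * ?n) \<le> 1 / (2 * 1)" using n1 by (intro divide_left_mono) auto
  then have "1 / (2 * ?n) \<le> 1" by (rule order_trans) simp
  then have \<beta>1: "\<beta> t \<le> 1" if "t \<ge> T" for t using \<beta>\<delta>[OF that] unfolding \<delta>_def by linarith
  have "1 * tail T \<le> C * tail T" using C1 tail0[OF T0] by (intro mult_right_mono)
  then have "tail T \<le> 1 / (2 * ?n)" using \<beta>T by (simp add: \<beta>_def \<delta>_def)
  then have ntail: "?n * tail T \<le> 1 / 2" using n1 by (simp add: field_simps)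

  define S :: "(((real ^ 'n) \<times> real) \<Rightarrow>\<^sub>C (real ^ 'n)) set" where
    "S = {w. (\<forall>t\<ge>T. \<forall>j. Ck_lip k (\<beta> t) (\<lambda>x. apply_bcontfun w (x, t) $ j)) \<and>
      (\<forall>x y t. (\<forall>i. x $ i - y $ i \<in> \<int>) \<longrightarrow> apply_bcontfun w (x, t) = apply_bcontfun w (y, t))}"
  \<comment> \<open>Times before \<open>T\<close> are clamped to \<open>T\<close>, so that \<open>F w\<close> is defined on the whole real line.\<close>
  define F where "F w = (\<lambda>(x, t). \<chi> j. - (LINT s:{max T t..}|lborel. Q (x + w (x, s)) s $ j))"
    for w :: "((real ^ 'n) \<times> real) \<Rightarrow>\<^sub>C (real ^ 'n)"

  have cont: "continuous_on {0..} (\<lambda>s. Q (x + apply_bcontfun w (x, s)) s $ j)" for w x j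
  proof -
    have "continuous_on {0..} (\<lambda>s. (\<lambda>(x, t). Q x t) (x + apply_bcontfun w (x, s), s))"
      by (rule continuous_on_compose2[OF contQ])
        (auto intro!: continuous_intros continuous_on_compose2[OF continuous_on_apply_bcontfun])
    then show ?thesis by (auto intro: continuous_on_component)
  qed
  have cont_t: "continuous_on {t..} (\<lambda>s. Q (x + apply_bcontfun w (x, s)) s $ j)"
    if "t \<ge> 0" for w x j t
    by (rule continuous_on_subset[OF cont]) (use that in auto)
  have QC: "Ck_lip k (C * b s) (\<lambda>x. Q (x + apply_bcontfun w (x, s)) s $ j)"
    if "w \<in> S" "s \<ge> T" for w s j
  proof (rule C[where w = "\<lambda>x. apply_bcontfun w (x, s)"])
    show "Ck_lip k (b s) (\<lambda>x. Q x s $ j)" using Q that T0 by simp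
    show "Ck_lip k 1 (\<lambda>x. apply_bcontfun w (x, s) $ j)" for j
      using that \<beta>1[of s] by (auto simp: S_def intro: Ck_lip_mono)
  qed
  have Cb_t: "set_integrable lborel {t..} (\<lambda>s. C * b s)" if "t \<ge> 0" for t
    using b_t[OF that] by simp
  have int: "set_integrable lborel {t..} (\<lambda>s. Q (x + apply_bcontfun w (x, s)) s $ j)"
    if "w \<in> S" "t \<ge> T" for w t x j
    by (rule Ck_lip_tail_integral(2)[where g = "\<lambda>x s. Q (x + apply_bcontfun w (x, s)) s $ j",
          OF cont_t QC[OF that(1)] Cb_t])
      (use that T0 in auto)
  have F_lip: "Ck_lip k (\<beta> (max T t)) (\<lambda>x. F w (x, t) $ j)" if w: "w \<in> S" for w t j
  proof -
    have "Ck_lip k (LINT s:{max T t..}|lborel. C * b s)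
        (\<lambda>x. LINT s:{max T t..}|lborel. Q (x + apply_bcontfun w (x, s)) s $ j)"
      by (rule Ck_lip_tail_integral(1)[where g = "\<lambda>x s. Q (x + apply_bcontfun w (x, s)) s $ j",
          OF cont_t QC[OF that(1)] Cb_t])
        (use T0 in auto)
    from Ck_lip_minus[OF this] show ?thesis by (simp add: F_def \<beta>_def tail_def)
  qed
  have F_t: "\<bar>F w (x, t) $ j - F w (x, t') $ j\<bar> \<le> b T * \<bar>t - t'\<bar>" if w: "w \<in> S" for w x t t' j
  proof -
    let ?g = "\<lambda>s. Q (x + apply_bcontfun w (x, s)) s $ j"
    let ?I = "\<lambda>t. LINT s:{t..}|lborel. ?g s"
    have bT: "\<bar>?g s\<bar> \<le> b T" if "s \<ge> T" for s
    proof -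
      have "\<bar>?g s\<bar> \<le> b s" using Q[of s j] T0 that by (auto intro: Ck_lip_bound)
      also have "b s \<le> b T" using b(2) T0 that by (auto simp: monotone_on_def)
      finally show ?thesis .
    qed
    have *: "\<bar>?I t - ?I t'\<bar> \<le> b T * (t' - t)" if t: "T \<le> t" "t \<le> t'" for t t'
    proof -
      have "?I t - ?I t' = integral {t..t'} ?g"
        using tail_integral_split[OF int[OF w t(1)] t(2)] by simp
      moreover have "norm (integral {t..t'} ?g) \<le> b T * (t' - t)"
        by (rule integral_bound[OF t(2) continuous_on_subset[OF cont]]) (use t T0 bT in auto)
      ultimately show ?thesis by simp
    qed
    have "\<bar>?I (max T t) - ?I (max T t')\<bar> \<le> b T * \<bar>max T t - max T t'\<bar>"
    proof (cases "max T t \<le> max T t'")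
      case True
      then have "\<bar>max T t - max T t'\<bar> = max T t' - max T t" by linarith
      then show ?thesis using *[of "max T t" "max T t'"] True by simp
    next
      case False
      then have le: "max T t' \<le> max T t" by linarith
      then have "\<bar>max T t - max T t'\<bar> = max T t - max T t'" by linarith
      then show ?thesis
        using *[OF max.cobounded1 le] by (simp only: abs_minus_commute[of "?I (max T t)"])
    qed
    also have "\<dots> \<le> b T * \<bar>t - t'\<bar>" using b0[OF T0] by (intro mult_left_mono) auto
    finally show ?thesis by (simp add: F_def abs_minus_commute)
  qed
  have F_bcontfun: "F w \<in> bcontfun" if w: "w \<in> S" for w
  proof (rule bcontfun_normI)
    show "continuous_on UNIV (F w)"
    proof (rule continuous_on_pointwise_lipschitz)
      show "\<bar>F w (x, t) $ j - F w (y, t) $ j\<bar> \<le> 1 * norm (x - y)" for x y t j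
        by (rule Ck_lip_lipschitz[OF Ck_lip_mono[OF F_lip[OF w] \<beta>1]]) simp
    qed (rule F_t[OF w])
    show "norm (F w p) \<le> ?n * 1" for p
    proof (rule norm_le_card)
      obtain x t where p: "p = (x, t)" by (cases p)
      show "\<bar>F w p $ j\<bar> \<le> 1" for j
        unfolding p by (rule Ck_lip_bound[OF Ck_lip_mono[OF F_lip[OF w] \<beta>1]]) simp
    qed
  qed
  define \<Phi> where "\<Phi> w = Bcontfun (F w)" for w
  have \<Phi>: "apply_bcontfun (\<Phi> w) = F w" if "w \<in> S" for w
    unfolding \<Phi>_def by (rule Bcontfun_inverse[OF F_bcontfun[OF that]])

  have "\<exists>!w\<in>S. \<Phi> w = w"
  proof (rule Banach_fix[where c = "1 / 2"])
    show "complete S"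
      unfolding complete_eq_closed closed_sequential_limits
    proof (intro allI impI, elim conjE)
      fix ws :: "nat \<Rightarrow> ((real ^ 'n) \<times> real) \<Rightarrow>\<^sub>C (real ^ 'n)" and w
      assume ws: "\<forall>m. ws m \<in> S" and lim: "ws \<longlonglongrightarrow> w"
      have pt: "(\<lambda>m. ws m p) \<longlonglongrightarrow> w p" for p
        by (rule metric_tendsto_imp_tendsto[OF lim]) (simp add: dist_bounded)
      have "Ck_lip k (\<beta> t) (\<lambda>x. w (x, t) $ j)" if "t \<ge> T" for t j
        by (rule Ck_lip_limit[where F = "\<lambda>m x. ws m (x, t) $ j"])
          (use ws that in \<open>auto simp: S_def intro: tendsto_vec_nth pt\<close>)
      moreover have "w (x, t) = w (y, t)" if "\<forall>i. x $ i - y $ i \<in> \<int>" for x y t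
      proof (rule LIMSEQ_unique[OF pt])
        have "(\<lambda>m. ws m (x, t)) = (\<lambda>m. ws m (y, t))" using ws that by (auto simp: S_def)
        then show "(\<lambda>m. ws m (x, t)) \<longlonglongrightarrow> w (y, t)" using pt by simp
      qed
      ultimately show "w \<in> S" by (auto simp: S_def)
    qed
    have "0 \<in> S" using \<beta>0 by (auto simp: S_def intro!: Ck_lip_const)
    then show "S \<noteq> {}" by blast
    show "\<Phi> ` S \<subseteq> S"
    proof clarify
      fix w assume w: "w \<in> S"
      have "F w (x, t) = F w (y, t)" if xy: "\<forall>i. x $ i - y $ i \<in> \<int>" for x y t
      proof -
        have "Q (x + w (x, s)) s = Q (y + w (y, s)) s" for s
        proof (rule per)
          have "w (x, s) = w (y, s)" using w xy by (auto simp: S_def)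
          then show "(x + w (x, s)) $ i - (y + w (y, s)) $ i \<in> \<int>" for i using xy by simp
        qed
        then show ?thesis by (simp add: F_def)
      qed
      moreover have "Ck_lip k (\<beta> t) (\<lambda>x. F w (x, t) $ j)" if "t \<ge> T" for t j
        using F_lip[OF w, of t j] that by (simp add: max_def)
      ultimately show "\<Phi> w \<in> S" unfolding S_def mem_Collect_eq \<Phi>[OF w] by blast
    qed
    show "dist (\<Phi> w) (\<Phi> v) \<le> 1 / 2 * dist w v" if w: "w \<in> S" and v: "v \<in> S" for w v
    proof (rule dist_bound)
      fix p :: "(real ^ 'n) \<times> real"
      obtain x t where p: "p = (x, t)" by (cases p)
      define t' where "t' = max T t"
      have t': "t' \<ge> T" "t' \<ge> 0" using T0 by (auto simp: t'_def)
      have comp: "\<bar>(F w p - F v p) $ j\<bar> \<le> tail T * dist w v" for j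
      proof -
        let ?g = "\<lambda>w s. Q (x + apply_bcontfun w (x, s)) s $ j"
        have le: "\<bar>?g w s - ?g v s\<bar> \<le> b s * dist w v" if "s \<ge> t'" for s
        proof -
          have "\<bar>?g w s - ?g v s\<bar> \<le> b s * norm ((x + w (x, s)) - (x + v (x, s)))"
            by (rule Ck_lip_lipschitz[OF Q]) (use that t' in simp)
          also have "\<dots> \<le> b s * dist w v"
            using dist_bounded[of w "(x, s)" v] b0[of s] that t'
            by (intro mult_left_mono) (auto simp: dist_norm)
          finally show ?thesis .
        qed
        have "\<bar>LINT s:{t'..}|lborel. ?g w s - ?g v s\<bar> \<le> (LINT s:{t'..}|lborel. b s * dist w v)"
          unfolding set_lebesgue_integral_def
        proof (rule integrable_dominated(2))
          show "integrable lborel (\<lambda>s. indicator {t'..} s *\<^sub>R (b s * dist w v))"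
            using set_integrable_mult_left[OF b_t[OF t'(2)]] unfolding set_integrable_def by blast
          show "(\<lambda>s. indicator {t'..} s *\<^sub>R (?g w s - ?g v s)) \<in> borel_measurable lborel"
            using borel_measurable_continuous_on_indicator[OF _ continuous_on_diff[OF cont_t cont_t]]
              t'(2) by simp
          show "\<bar>indicator {t'..} s *\<^sub>R (?g w s - ?g v s)\<bar> \<le> indicator {t'..} s *\<^sub>R (b s * dist w v)" for s
            using le by (auto simp: indicator_def)
        qed
        also have "\<dots> = tail t' * dist w v" by (simp add: tail_def)
        also have "\<dots> \<le> tail T * dist w v" using tail_mono[OF t'(1)] by (rule mult_right_mono) simp
        finally show ?thesis
          using int[OF w t'(1), of x j] int[OF v t'(1), of x j]
          by (simp add: F_def p t'_def[symmetric] abs_minus_commute)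
      qed
      have "norm (F w p - F v p) \<le> ?n * (tail T * dist w v)" by (rule norm_le_card[OF comp])
      also have "\<dots> \<le> 1 / 2 * dist w v"
        using mult_right_mono[OF ntail, of "dist w v"] by (simp add: mult.assoc)
      finally show "dist (\<Phi> w p) (\<Phi> v p) \<le> 1 / 2 * dist w v"
        using \<Phi>[OF w] \<Phi>[OF v] by (simp add: dist_norm)
    qed
  qed auto
  then obtain w where w: "w \<in> S" and fix_w: "F w = apply_bcontfun w" using \<Phi> by metis
  have F_w: "F w (x, t) $ j = - (LINT s:{max T t..}|lborel. Q (x + w (x, s)) s $ j)" for x t j
    by (simp add: F_def)
  show ?thesis
  proof (rule that[of T \<beta> "\<lambda>x t. w (x, t)", OF T0])
    show "Ck_lip k (\<beta> t) (\<lambda>x. w (x, t) $ j)" if "t \<ge> T" for t j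
      using w that by (auto simp: S_def)
    show "\<beta> t \<le> e" if "t \<ge> T" for t using \<beta>\<delta>[OF that] by (simp add: \<delta>_def)
    show "(\<beta> \<longlongrightarrow> 0) at_top" by (rule \<beta>_lim)
    show "w (x, t) = w (y, t)" if "\<And>i. x $ i - y $ i \<in> \<int>" for x y t
      using w that by (auto simp: S_def)
    show "continuous_on UNIV (\<lambda>(x, t). w (x, t))" by (simp add: case_prod_unfold)
    show "((\<lambda>t. w (x, t)) has_vector_derivative Q (x + w (x, t)) t) (at t within {T..})"
      if t: "t \<ge> T" for x t
      unfolding has_vector_derivative_def
    proof (rule has_derivative_vecI)
      fix j
      have w_eq: "- (LINT s:{t..}|lborel. Q (x + w (x, s)) s $ j) = w (x, t) $ j" if "t \<ge> T" for t
        using fun_cong[OF fix_w, of "(x, t)"] that by (metis (no_types, lifting) F_w max.absorb2)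
      have "((\<lambda>t. LINT s:{t..}|lborel. Q (x + w (x, s)) s $ j) has_real_derivative
          - (Q (x + w (x, t)) t $ j)) (at t within {T..})"
        by (rule tail_integral_has_derivative[OF int[OF w order_refl] cont_t[OF T0] t])
      from DERIV_minus[OF this]
      have "((\<lambda>t. - (LINT s:{t..}|lborel. Q (x + w (x, s)) s $ j)) has_real_derivative
          Q (x + w (x, t)) t $ j) (at t within {T..})" by simp
      then have "((\<lambda>t. w (x, t) $ j) has_real_derivative Q (x + w (x, t)) t $ j) (at t within {T..})"
        by (rule has_field_derivative_transform_within[where d = 1])
          (use t w_eq in auto)
      then show "((\<lambda>t. w (x, t) $ j) has_derivative (\<lambda>h. (h *\<^sub>R Q (x + w (x, t)) t) $ j))
          (at t within {T..})"
        by (simp add: has_field_derivative_def mult_commute_abs)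
    qed
  qed
qed

section \<open>The asymptotic torus\<close>

lemma to_torus_rep_torus: "to_torus (rep_torus q) = q"
  by (metis Quotient_abs_rep Quotient_torus)

lemma holder_norm_vec_tendsto_0:
  fixes f :: "'a \<Rightarrow> 'n::finite torus \<Rightarrow> real ^ 'm::finite"
  assumes "\<forall>\<^sub>F t in F. \<forall>j. Ck_lip (nat \<lfloor>\<sigma>\<rfloor>) (\<beta> t) (\<lambda>x. f t (to_torus x) $ j)"
    and "(\<beta> \<longlongrightarrow> 0) F"
  shows "((\<lambda>t. holder_norm_vec \<sigma> (f t)) \<longlongrightarrow> 0) F"
proof (rule tendsto_sandwich[where f = "\<lambda>_. 0"])
  show "\<forall>\<^sub>F t in F. holder_norm_vec \<sigma> (f t) \<le> ennreal (3 * \<beta> t)"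
    using assms(1) by eventually_elim (auto intro: holder_norm_vec_le)
  have "((\<lambda>t. 3 * \<beta> t) \<longlongrightarrow> 0) F" by (rule tendsto_mult_right_zero[OF assms(2)])
  then show "((\<lambda>t. ennreal (3 * \<beta> t)) \<longlongrightarrow> 0) F" using tendsto_ennrealI by fastforce
qed auto

text \<open>Along the line \<open>x - s \<omega>\<close> both arguments of \<open>w\<close> move.  Joint differentiability
  within \<open>UNIV \<times> {T..}\<close> follows from the joint continuity of the time derivative \<open>V\<close>,
  combined with the space derivative at the single point considered.\<close>

lemma velocity_along_line:
  fixes w :: "real ^ 'n \<Rightarrow> real \<Rightarrow> real ^ 'n"
  assumes D: "((\<lambda>y. w y t) has_derivative D) (at (x - t *\<^sub>R \<omega>))"
    and V: "\<And>y s. s \<ge> T \<Longrightarrow> ((\<lambda>s. w y s) has_vector_derivative V y s) (at s within {T..})"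
    and cont: "continuous_on (UNIV \<times> {T..}) (\<lambda>(y, s). V y s)"
    and t: "t \<ge> T"
  shows "((\<lambda>s. w (x - s *\<^sub>R \<omega>) s) has_vector_derivative V (x - t *\<^sub>R \<omega>) t - D \<omega>) (at t within {T..})"
proof -
  let ?y = "x - t *\<^sub>R \<omega>"
  have lin: "bounded_linear D" using D by (rule has_derivative_bounded_linear)
  have "((\<lambda>(y, s). w y s) has_derivative (\<lambda>(h, r). D h + blinfun_scaleR_left (V ?y t) r))
      (at (?y, t) within UNIV \<times> {T..})" (is "(_ has_derivative ?L) _")
  proof (rule has_derivative_partialsI[where fy = "\<lambda>y s. blinfun_scaleR_left (V y s)"])
    show "((\<lambda>s. w y s) has_derivative blinfun_apply (blinfun_scaleR_left (V y s))) (at s within {T..})"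
      if "s \<in> {T..}" for y s
      using V[of s y] that by (simp add: has_vector_derivative_def)
    have "continuous_on (UNIV \<times> {T..}) (\<lambda>p. blinfun_scaleR_left (case p of (y, s) \<Rightarrow> V y s))"
      by (rule bounded_linear.continuous_on[OF bounded_linear_blinfun_scaleR_left cont])
    then have "continuous_on (UNIV \<times> {T..}) (\<lambda>(y, s). blinfun_scaleR_left (V y s))"
      by (simp add: case_prod_unfold)
    then show "continuous (at (?y, t) within UNIV \<times> {T..}) (\<lambda>(y, s). blinfun_scaleR_left (V y s))"
      using t by (auto simp: continuous_on_eq_continuous_within)
  qed (use D t in auto)
  then have "((\<lambda>(y, s). w y s) has_derivative ?L)
      (at (x - t *\<^sub>R \<omega>, t) within (\<lambda>s. (x - s *\<^sub>R \<omega>, s)) ` {T..})"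
    by (rule has_derivative_subset) auto
  moreover have "((\<lambda>s. (x - s *\<^sub>R \<omega>, s)) has_derivative (\<lambda>r. (- (r *\<^sub>R \<omega>), r))) (at t within {T..})"
    by (auto intro!: derivative_eq_intros)
  ultimately have "((\<lambda>s. (\<lambda>(y, s). w y s) (x - s *\<^sub>R \<omega>, s)) has_derivative
      (\<lambda>r. ?L (- (r *\<^sub>R \<omega>), r))) (at t within {T..})"
    by (rule has_derivative_in_compose[rotated])
  moreover have "D (- (r *\<^sub>R \<omega>)) = - (r *\<^sub>R D \<omega>)" for r
    using linear_scale linear_neg bounded_linear.linear[OF lin] by metis
  ultimately show ?thesis
    by (simp add: has_vector_derivative_def algebra_simps)
qed

theorem corollaryA:
  fixes \<sigma> :: real
    and \<omega> :: "real ^ 'n::finite"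
    and bP :: "real \<Rightarrow> real"
    and P Z :: "'n torus \<Rightarrow> real \<Rightarrow> real ^ 'n"
  assumes "\<sigma> \<ge> 1"
    and "\<forall>t\<ge>0. bP t > 0"
    and "antimono_on {0..} bP"
    and "set_integrable lborel {0..} bP"
    and "\<forall>q. \<forall>t\<ge>0. Z q t = \<omega> + P q t"
    and "P \<in> Sbar_space_vec 0 \<sigma> 1"
    and "\<forall>t\<ge>0. holder_norm_vec (\<sigma> + 1) (\<lambda>q. P q t) \<le> ennreal (bP t)"
  shows "\<exists>\<psi>. asymptotic_KAM_torus \<sigma> \<omega> 0 Z (\<lambda>q t. \<omega>) id \<psi>"
proof -
  let ?n = "real CARD('n)"
  define k where "k = nat \<lfloor>\<sigma>\<rfloor>"
  define b where "b t = ?n * bP t" for t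
  define Q where "Q x t = P (to_torus (x + t *\<^sub>R \<omega>)) t" for x t
  have Suc_k: "nat \<lfloor>\<sigma> + 1\<rfloor> = Suc k" using assms(1) by (simp add: k_def nat_add_distrib)
  then have Suc_k': "nat (\<lfloor>\<sigma>\<rfloor> + 1) = Suc k" by simp
  obtain k' where k': "k = Suc k'" using assms(1) by (cases k) (auto simp: k_def)

  have PS: "(\<lambda>q t. P q t $ j) \<in> S_space 0 (\<sigma> + 1)" for j
    using assms(6) by (simp add: Sbar_space_vec_def Sbar_space_def)
  have contP: "continuous_on (UNIV \<times> {0..}) (\<lambda>(q, t). P q t)"
  proof -
    have "continuous_on (UNIV \<times> {0..}) (\<lambda>p. \<chi> j. (case p of (q, t) \<Rightarrow> P q t $ j))"
      using PS by (intro continuous_on_vec_lambda) (simp add: S_space_def)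
    then show ?thesis by (simp add: case_prod_unfold)
  qed
  have P_Ck: "Ck_lip k (b t) (\<lambda>x. P (to_torus x) t $ j)" if t: "t \<ge> 0" for t j
    unfolding b_def
  proof (rule Ck_lip_of_torus_Ck[where f = "\<lambda>q. P q t $ j"])
    show "torus_Ck (Suc k) (\<lambda>q. P q t $ j)"
      using PS[of j] t by (simp add: S_space_def holder_class_def Suc_k')
    show "\<bar>torus_pderivs \<alpha> (\<lambda>q. P q t $ j) q\<bar> \<le> bP t" if "length \<alpha> \<le> Suc k" for \<alpha> q
      by (rule abs_torus_pderivs_le_holder_norm_vec[of "\<sigma> + 1"])
        (use assms(2,7) t that in \<open>auto simp: Suc_k' intro: less_imp_le\<close>)
  qed
  have b_int: "set_integrable lborel {0..} b" using assms(4) unfolding b_def[abs_def] by simp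
  have b_anti: "antimono_on {0..} b" using assms(3) by (auto simp: b_def monotone_on_def)
  have b0: "0 \<le> b t" if "t \<ge> 0" for t using P_Ck[OF that] by (rule Ck_lip_nonneg)
  have b_lim: "(b \<longlongrightarrow> 0) at_top"
  proof (rule tendsto_sandwich)
    show "\<forall>\<^sub>F t in at_top. 0 \<le> b t" using eventually_ge_at_top[of 0] by eventually_elim (rule b0)
    \<comment> \<open>A decreasing integrable function tends to 0, since it is bounded by its own integral over
      \<open>{t - 1..}\<close>.\<close>
    show "\<forall>\<^sub>F t in at_top. b t \<le> (LINT s:{- 1 + t..}|lborel. b s)"
      using eventually_ge_at_top[of 1]
    proof eventually_elim
      case (elim t)
      then show ?case using antimono_le_tail_integral[OF b_int b_anti b0, of "t - 1"] by simp
    qed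
    have "filterlim (\<lambda>t :: real. - 1 + t) at_top at_top"
      by (rule filterlim_tendsto_add_at_top[OF tendsto_const filterlim_ident])
    then show "((\<lambda>t. LINT s:{- 1 + t..}|lborel. b s) \<longlongrightarrow> 0) at_top"
      by (rule filterlim_compose[OF tail_integral_tendsto_0[OF b_int]])
  qed auto

  have contQ: "continuous_on (UNIV \<times> {0..}) (\<lambda>(x, t). Q x t)"
  proof -
    have "continuous_on (UNIV \<times> {0..})
        (\<lambda>p. (\<lambda>(q, t). P q t) (to_torus (fst p + snd p *\<^sub>R \<omega>), snd p))"
      by (rule continuous_on_compose2[OF contP])
        (auto intro!: continuous_intros continuous_on_compose2[OF continuous_on_to_torus[of UNIV]])
    then show ?thesis by (simp add: Q_def case_prod_unfold)
  qed
  \<comment> \<open>This size of \<open>\<beta> t\<close> makes \<open>u t\<close> a contraction with constant 1/2, in the form required by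
    \<open>torus_embedding_displacement\<close>.\<close>
  have e: "1 / (2 * ?n * ?n) > 0" by simp
  obtain T w \<beta> where T: "T \<ge> 0"
    and w_Ck: "\<And>t j. t \<ge> T \<Longrightarrow> Ck_lip k (\<beta> t) (\<lambda>x. w x t $ j)"
    and \<beta>_le: "\<And>t. t \<ge> T \<Longrightarrow> \<beta> t \<le> 1 / (2 * ?n * ?n)" and \<beta>_lim: "(\<beta> \<longlongrightarrow> 0) at_top"
    and w_per: "\<And>x y t. (\<And>i. x $ i - y $ i \<in> \<int>) \<Longrightarrow> w x t = w y t"
    and w_cont: "continuous_on UNIV (\<lambda>(x, t). w x t)"
    and w_ode: "\<And>x t. t \<ge> T \<Longrightarrow>
      ((\<lambda>t. w x t) has_vector_derivative Q (x + w x t) t) (at t within {T..})"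
  proof (rule solution_vanishing_at_infinity[OF contQ _ _ b_int b_anti e])
    show "Ck_lip k (b t) (\<lambda>x. Q x t $ j)" if "t \<ge> 0" for t j
      unfolding Q_def by (rule Ck_lip_translate[OF P_Ck[OF that]])
    show "Q x t = Q y t" if "\<And>i. x $ i - y $ i \<in> \<int>" for x y t
    proof -
      have "to_torus x = to_torus y" using that to_torus_eq_iff by blast
      then show ?thesis by (simp add: Q_def to_torus_add)
    qed
  qed blast

  define u where "u t q = w (rep_torus q - t *\<^sub>R \<omega>) t" for t q
  define \<psi> where "\<psi> t q = q + to_torus (u t q)" for t q
  have u_lift: "u t (to_torus x) = w (x - t *\<^sub>R \<omega>) t" for t x
    unfolding u_def
  proof (rule w_per)
    have "rep_torus (to_torus x) $ i - x $ i \<in> \<int>" for i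
      using to_torus_eq_iff to_torus_rep_torus by blast
    then show "(rep_torus (to_torus x) - t *\<^sub>R \<omega>) $ i - (x - t *\<^sub>R \<omega>) $ i \<in> \<int>" for i by simp
  qed
  have u_Ck: "Ck_lip k (\<beta> t) (\<lambda>x. u t (to_torus x) $ j)" if "t \<ge> T" for t j
    using Ck_lip_translate[OF w_Ck[OF that], of "- (t *\<^sub>R \<omega>)"] by (simp add: u_lift)
  have \<beta>_small: "?n * (?n * \<beta> t) \<le> 1 / 2" if "t \<ge> T" for t
    using \<beta>_le[OF that] by (simp add: field_simps)

  \<comment> \<open>With \<open>k = 0\<close> the setting asks for convergence of the vector fields in \<open>C\<^sup>\<sigma>\<close>, which follows from
    \<open>P\<^sup>t\<close> being in the ball of radius \<open>b t\<close>.\<close>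
  have setting: "KAM_setting \<sigma> \<omega> 0 0 Z (\<lambda>q t. \<omega>) id"
    unfolding KAM_setting_def
  proof (intro conjI allI impI)
    fix t :: real assume t: "t \<ge> 0"
    have "Ck_lip k (\<bar>\<omega> $ j\<bar> + b t) (\<lambda>x. Z (to_torus x) t $ j)" for j
      using Ck_lip_add[OF Ck_lip_const[OF order_refl] P_Ck[OF t], of "\<omega> $ j" j] assms(5) t by simp
    then show "holder_class_vec (\<sigma> + real 0) (\<lambda>q. Z q t)"
      unfolding holder_class_vec_def k_def by (auto intro: holder_class_of_Ck_lip)
    have "Ck_lip (nat \<lfloor>\<sigma>\<rfloor>) \<bar>\<omega> $ j\<bar> (\<lambda>x :: real ^ 'n. \<omega> $ j)" for j by (rule Ck_lip_const) simp
    then show "holder_class_vec (\<sigma> + real 0) (\<lambda>q :: 'n torus. \<omega>)"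
      unfolding holder_class_vec_def by (auto intro: holder_class_of_Ck_lip)
  next
    have "torus_embedding \<sigma> (\<lambda>q :: 'n torus. q + to_torus 0)"
      by (rule torus_embedding_displacement[where B = 0, OF assms(1)]) (auto intro: Ck_lip_const)
    then show "torus_embedding \<sigma> (id :: 'n torus \<Rightarrow> 'n torus)" by (simp add: to_torus_0 id_def)
  next
    show "((\<lambda>t. holder_norm_vec (\<sigma> + real 0) (\<lambda>q. Z q t - \<omega>)) \<longlongrightarrow> 0) at_top"
    proof (rule holder_norm_vec_tendsto_0[OF _ b_lim])
      show "\<forall>\<^sub>F t in at_top. \<forall>j. Ck_lip (nat \<lfloor>\<sigma> + real 0\<rfloor>) (b t) (\<lambda>x. (Z (to_torus x) t - \<omega>) $ j)"
        using eventually_ge_at_top[of 0]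
        by eventually_elim (use P_Ck assms(5) in \<open>simp add: k_def\<close>)
    qed
  next
    fix q :: "'n torus"
    have "torus_has_derivative (\<lambda>q. q + to_torus 0) (\<lambda>v. v + 0) (to_torus (rep_torus q))"
      by (rule torus_has_derivative_displacement) simp
    then have "torus_has_derivative id (\<lambda>v. v) q" by (simp add: to_torus_0 to_torus_rep_torus id_def)
    then show "\<exists>D. torus_has_derivative id D q \<and> \<omega> = D \<omega>" by blast
  qed simp

  have "torus_maps_tendsto \<sigma> \<psi> id"
    unfolding torus_maps_tendsto_def
  proof (intro exI[of _ u] conjI)
    show "\<forall>\<^sub>F t in at_top. holder_class_vec \<sigma> (u t) \<and> (\<forall>q. \<psi> t q - id q = to_torus (u t q))"
      using eventually_ge_at_top[of T]
    proof eventually_elim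
      case (elim t)
      then show ?case
        using u_Ck[OF elim] by (auto simp: \<psi>_def holder_class_vec_def k_def intro: holder_class_of_Ck_lip)
    qed
    have "\<forall>\<^sub>F t in at_top. \<forall>j. Ck_lip (nat \<lfloor>\<sigma>\<rfloor>) (\<beta> t) (\<lambda>x. u t (to_torus x) $ j)"
      using eventually_ge_at_top[of T] by eventually_elim (use u_Ck in \<open>simp add: k_def\<close>)
    then show "((\<lambda>t. holder_norm_vec \<sigma> (u t)) \<longlongrightarrow> 0) at_top"
      by (rule holder_norm_vec_tendsto_0[OF _ \<beta>_lim])
  qed
  moreover have "torus_embedding \<sigma> (\<psi> t)" if "t \<ge> T" for t
    unfolding \<psi>_def
    by (rule torus_embedding_displacement[OF assms(1) u_Ck[OF that, unfolded k_def] \<beta>_small[OF that]])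
  moreover have "\<exists>D v. torus_has_derivative (\<psi> t) D q \<and>
      torus_has_velocity (\<lambda>s. \<psi> s q) v t {T..} \<and> Z (\<psi> t q) t = D \<omega> + v"
    if t: "t \<ge> T" for q t
  proof -
    let ?x = "rep_torus q"
    let ?y = "?x - t *\<^sub>R \<omega>"
    obtain D where D: "((\<lambda>x. u t (to_torus x)) has_derivative D) (at ?x)"
      using derivative_displacement[OF u_Ck[OF t, unfolded k'] \<beta>_small[OF t]] by blast
    have "((\<lambda>x. u t (to_torus x)) has_derivative D) (at (?y + t *\<^sub>R \<omega>))" using D by simp
    then have "((\<lambda>y. u t (to_torus (y + t *\<^sub>R \<omega>))) has_derivative D) (at ?y)"
      by (rule has_derivative_compose[rotated]) (auto intro!: derivative_eq_intros)
    then have Dw: "((\<lambda>y. w y t) has_derivative D) (at ?y)" by (simp add: u_lift)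
    have cont: "continuous_on (UNIV \<times> {T..}) (\<lambda>(y, s). Q (y + w y s) s)"
    proof -
      have "continuous_on (UNIV \<times> {T..}) (\<lambda>p. w (fst p) (snd p))"
        using continuous_on_subset[OF w_cont] by (simp add: case_prod_unfold)
      then have "continuous_on (UNIV \<times> {T..})
          (\<lambda>p. (\<lambda>(x, t). Q x t) (fst p + w (fst p) (snd p), snd p))"
        by (intro continuous_on_compose2[OF contQ]) (use T in \<open>auto intro!: continuous_intros\<close>)
      then show ?thesis by (simp add: case_prod_unfold)
    qed
    \<comment> \<open>The transport term \<open>- D \<omega>\<close> of the velocity cancels the \<open>D \<omega>\<close> in the image of \<open>\<omega>\<close> under the
      derivative \<open>id + D\<close> of \<open>\<psi> t\<close>.\<close>
    let ?v = "Q (?y + w ?y t) t - D \<omega>"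
    have "((\<lambda>s. w (?x - s *\<^sub>R \<omega>) s) has_vector_derivative ?v) (at t within {T..})"
      by (rule velocity_along_line[where V = "\<lambda>y s. Q (y + w y s) s", OF Dw w_ode cont t])
    then have "((\<lambda>s. ?x + w (?x - s *\<^sub>R \<omega>) s) has_vector_derivative 0 + ?v) (at t within {T..})"
      by (intro has_vector_derivative_add has_vector_derivative_const)
    moreover have "to_torus (?x + w (?x - s *\<^sub>R \<omega>) s) = \<psi> s q" for s
      by (simp add: \<psi>_def u_def to_torus_add to_torus_rep_torus)
    ultimately have "torus_has_velocity (\<lambda>s. \<psi> s q) ?v t {T..}"
      unfolding torus_has_velocity_def by (intro exI[of _ "\<lambda>s. ?x + w (?x - s *\<^sub>R \<omega>) s"]) simp
    moreover have "torus_has_derivative (\<psi> t) (\<lambda>v. v + D v) q"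
      using torus_has_derivative_displacement[OF D] by (simp add: \<psi>_def[abs_def] to_torus_rep_torus)
    moreover have "Z (\<psi> t q) t = (\<omega> + D \<omega>) + ?v"
    proof -
      have "to_torus (?y + w ?y t + t *\<^sub>R \<omega>) = to_torus (?x + w ?y t)"
        by (rule arg_cong[where f = to_torus]) simp
      then have "Q (?y + w ?y t) t = P (\<psi> t q) t"
        by (simp add: Q_def \<psi>_def u_def to_torus_add to_torus_rep_torus)
      then show ?thesis using assms(5) t T by simp
    qed
    ultimately show ?thesis by blast
  qed
  ultimately have "asymptotic_KAM_torus \<sigma> \<omega> 0 Z (\<lambda>q t. \<omega>) id \<psi>"
    unfolding asymptotic_KAM_torus_def using setting T by blast
  then show ?thesis by blast
qed

end
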